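(* Suppose $n=1$ and $m>0$. Then there is a constant $C$ such that $$\left\||D_x|^{(m-1)/2}e^{it|D_x|^m}\varphi(x)\right\|_{L^2(\mathbb{R}_t)}\leq C\|\varphi\|_{L^2(\mathbb{R}_x)}\qquad(\mathrm{I})$$ for all $x\in\mathbb{R}$ (and all $\varphi$). Suppose $n=2$ and $m>0$. Then there is a constant $C$ such that $$\left\||D_y|^{(m-1)/2}e^{itD_x|D_y|^{m-1}}\varphi(x,y)\right\|_{L^2(\mathbb{R}_t\times\mathbb{R}_y)}\leq C\|\varphi\|_{L^2(\mathbb{R}^2_{x,y})}\qquad(\mathrm{II})$$ for all $x\in\mathbb{R}$ (and all $\varphi$). Each of the estimates (I) and (II) is equivalent to itself with $m=1$, that is, to $\|e^{it|D_x|}\varphi(x)\|_{L^2(\mathbb{R}_t)}\leq C\|\varphi\|_{L^2(\mathbb{R}_x)}$ for all $x\in\mathbb{R}$, and to $\|e^{itD_x}\varphi(x,y)\|_{L^2(\mathbb{R}_t\times\mathbb{R}_y)}\leq C\|\varphi\|_{L^2(\mathbb{R}^2_{x,y})}$ for all $x\in\mathbb{R}$, respectively.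
   Context: Notation: $D_x=\frac1i\frac{\partial}{\partial x}$, $D_y=\frac1i\frac{\partial}{\partial y}$; functions of $D_x$ (and $D_y$) are Fourier multipliers, obtained by replacing $D_x$ by $\xi$ and $D_y$ by $\eta$ in the symbol, where $(\xi,\eta)$ are the Fourier variables dual to $(x,y)$. For example, $|D_y|^{(m-1)/2}e^{itD_x|D_y|^{m-1}}$ has symbol $|\eta|^{(m-1)/2}e^{it\xi|\eta|^{m-1}}$. In (I) the point $x$ is fixed and the norm is in $t$; in (II) $x$ is fixed and the norm is in $(t,y)$. The constants $C$ do not depend on $x$ or $\varphi$. *)

theory Defs
  imports "HOL-Analysis.Analysis"
begin

definition L2 :: "('a::euclidean_space \<Rightarrow> complex) set" where
  "L2 = {f \<in> borel_measurable lborel. integrable lborel (\<lambda>x. (cmod (f x))\<^sup>2)}"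

definition L2norm :: "('a::euclidean_space \<Rightarrow> complex) \<Rightarrow> real" where
  "L2norm f = sqrt (LINT x|lborel. (cmod (f x))\<^sup>2)"

definition has_L2_limit :: "(real \<Rightarrow> 'a::euclidean_space \<Rightarrow> complex) \<Rightarrow> ('a \<Rightarrow> complex) \<Rightarrow> bool"
    (infix "has'_L2'_limit" 46) where
  "F has_L2_limit f \<longleftrightarrow> (\<forall>R. F R \<in> L2) \<and> f \<in> L2 \<and>
     ((\<lambda>R. L2norm (\<lambda>x. F R x - f x)) \<longlongrightarrow> 0) at_top"

text \<open>The Fourier transform on $L^2$, with kernel $e^{-i x \cdot \xi}$, as the $L^2$-limit of the
  transforms of the truncations of \<open>\<phi>\<close> to balls. The limit is unique only almost everywhere; the
  choice of representative does not affect the integrals below.\<close>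

definition fourier_L2 :: "('a::euclidean_space \<Rightarrow> complex) \<Rightarrow> 'a \<Rightarrow> complex" where
  "fourier_L2 \<phi> = (SOME g.
     (\<lambda>R \<xi>. LINT x:cball 0 R|lborel. exp (- \<i> * of_real (x \<bullet> \<xi>)) * \<phi> x) has_L2_limit g)"

text \<open>The value at \<open>x\<close> of $a(D)\varphi$ with frequencies restricted to $|\xi| \le R$, where $a(D)$ is
  the Fourier multiplier with symbol \<open>a\<close>. For \<open>\<phi> \<in> L2\<close> the integral converges absolutely as soon
  as \<open>a\<close> is locally square integrable, which holds for all symbols considered here.\<close>

definition multiplier_trunc ::
    "('a::euclidean_space \<Rightarrow> complex) \<Rightarrow> ('a \<Rightarrow> complex) \<Rightarrow> real \<Rightarrow> 'a \<Rightarrow> complex" where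
  "multiplier_trunc a \<phi> R x =
     (LINT \<xi>:cball 0 R|lborel. exp (\<i> * of_real (x \<bullet> \<xi>)) * a \<xi> * fourier_L2 \<phi> \<xi>)
       / of_real ((2 * pi) ^ DIM('a))"

text \<open>For fixed \<open>x\<close> and arbitrary \<open>\<phi> \<in> L2\<close>, the function $t \mapsto a_t(D)\varphi(x)$
  (resp. $(t,y) \mapsto a_t(D)\varphi(x,y)$) is not given by an absolutely convergent integral in
  general. It is the limit \<open>u\<close> of its frequency truncations in $L^2(\mathbb{R}_t)$
  (resp. $L^2(\mathbb{R}_t \times \mathbb{R}_y)$), whose existence is part of the estimate. Whenever
  $a_t \hat\varphi$ is integrable for every \<open>t\<close>, \<open>u\<close> is almost everywhere the usual inverse Fourier
  integral of $a_t \hat\varphi$ at \<open>x\<close> (resp. at $(x,y)$).\<close>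

definition time_estimate_1d :: "(real \<Rightarrow> real \<Rightarrow> complex) \<Rightarrow> bool" where
  "time_estimate_1d a \<longleftrightarrow>
     (\<exists>C. \<forall>x. \<forall>\<phi>\<in>L2. \<exists>u.
        (\<lambda>R t. multiplier_trunc (a t) \<phi> R x) has_L2_limit u \<and>
        L2norm u \<le> C * L2norm \<phi>)"

definition time_estimate_2d :: "(real \<Rightarrow> real \<times> real \<Rightarrow> complex) \<Rightarrow> bool" where
  "time_estimate_2d a \<longleftrightarrow>
     (\<exists>C. \<forall>x. \<forall>\<phi>\<in>L2. \<exists>u.
        (\<lambda>R (t, y). multiplier_trunc (a t) \<phi> R (x, y)) has_L2_limit u \<and>
        L2norm u \<le> C * L2norm \<phi>)"

text \<open>Since \<open>0 powr a = 0\<close> for every \<open>a\<close>, these symbols differ from the literal ones at most where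
  $\xi = 0$ (resp. $\eta = 0$), a null set.\<close>

definition symbol_1d :: "real \<Rightarrow> real \<Rightarrow> real \<Rightarrow> complex" where
  "symbol_1d m t \<xi> =
     of_real (\<bar>\<xi>\<bar> powr ((m - 1) / 2)) * exp (\<i> * of_real (t * \<bar>\<xi>\<bar> powr m))"

definition symbol_2d :: "real \<Rightarrow> real \<Rightarrow> real \<times> real \<Rightarrow> complex" where
  "symbol_2d m t = (\<lambda>(\<xi>, \<eta>).
     of_real (\<bar>\<eta>\<bar> powr ((m - 1) / 2)) * exp (\<i> * of_real (t * \<xi> * \<bar>\<eta>\<bar> powr (m - 1))))"

end

theory Submission
  imports Defs "HOL-Probability.Characteristic_Functions"
begin

text \<open>All four estimates are instances of one bound. Fix \<open>x\<close>, and write \<open>\<tau>\<close> for the variables of the norm: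
  $\tau = t$ in one dimension, $\tau = (t, y)$ in two. As a function of \<open>\<tau>\<close>, the quantity to be
  estimated is
  $$\int e^{i \tau \cdot \Phi(\xi)} \sqrt{w(\xi)}\, h(\xi)\,d\xi,$$
  where \<open>h\<close> is $\hat\varphi$ times a constant and the unimodular factor $e^{i x \xi}$, and \<open>w\<close> is, up to
  a constant, the Jacobian of the phase map \<open>\<Phi>\<close>. In one dimension $\Phi(\xi) = |\xi|^m$ and
  $w(\xi) = m |\xi|^{m-1}$; in two dimensions $\Phi(\xi, \eta) = (\xi |\eta|^{m-1}, \eta)$ and
  $w(\xi, \eta) = |\eta|^{m-1}$. The power $(m-1)/2$ in the statement is precisely the one for which
  the symbol contains the square root of the Jacobian. Substituting $s = \Phi(\xi)$, on each half-line
  separately in one dimension, would turn the integral into Fourier transforms of functions whose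
  $L^2$ norms are at most that of \<open>h\<close>, up to a constant, and Plancherel's theorem would finish.

  The proof merges the substitution with the proof of the Plancherel inequality, so that no inverse of
  \<open>\<Phi>\<close> is needed. The locale \<open>weighted_phase\<close> records that \<open>\<Phi>\<close> pushes $w\,d\xi$ forward to at most \<open>B\<close>
  times Lebesgue measure. Lemma \<open>gauss_regularised_bound\<close> integrates the square of the transform
  against a Gaussian, expands it into a double integral, and applies the pushforward hypothesis;
  \<open>osc_energy_le\<close> removes the Gaussian. The result is an $L^2$ bound with constant $B (2\pi)^n$, where
  \<open>n\<close> is the dimension of the range of \<open>\<Phi>\<close>. Completeness of $L^2$ (\<open>L2_complete\<close>) then gives the limits of
  the frequency truncations.

  The phase $\Phi(\xi) = -\xi$ with $w = 1$ yields existence and boundedness of the Fourier transform on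
  $L^2$; the two phases above yield the two estimates; the phases $|\xi|$ and the identity with
  $w = 1$ yield the estimates for $m = 1$. The asserted equivalences hold because both of their sides
  do.\<close>

section \<open>Square integrable functions and their limits\<close>

text \<open>The square of the $L^2$ norm as an extended nonnegative number, so that monotonicity, Tonelli and
  Fatou apply without integrability side conditions.\<close>
definition energy :: "('a::euclidean_space \<Rightarrow> complex) \<Rightarrow> ennreal" where
  "energy f = (\<integral>\<^sup>+x. ennreal ((cmod (f x))\<^sup>2) \<partial>lborel)"

lemma L2_measurable: "f \<in> L2 \<Longrightarrow> f \<in> borel_measurable borel"
  by (simp add: L2_def)

lemma L2_iff_energy: "f \<in> L2 \<longleftrightarrow> f \<in> borel_measurable borel \<and> energy f < \<infinity>"
  by (auto simp: L2_def energy_def integrable_iff_bounded)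

lemma energy_eq_L2norm: "f \<in> L2 \<Longrightarrow> energy f = ennreal ((L2norm f)\<^sup>2)"
  by (simp add: L2_def L2norm_def energy_def nn_integral_eq_integral)

lemma L2norm_nonneg [simp]: "0 \<le> L2norm f"
  by (simp add: L2norm_def)

lemma cmod_add_square_le: "(cmod (a + b))\<^sup>2 \<le> 2 * (cmod a)\<^sup>2 + 2 * (cmod b)\<^sup>2"
proof -
  have "(cmod (a + b))\<^sup>2 \<le> (cmod a + cmod b)\<^sup>2"
    by (intro power_mono norm_triangle_ineq) simp
  also have "\<dots> \<le> 2 * (cmod a)\<^sup>2 + 2 * (cmod b)\<^sup>2"
    using zero_le_power2[of "cmod a - cmod b"] by (simp add: power2_eq_square algebra_simps)
  finally show ?thesis .
qed

text \<open>Constants in the estimates are not tracked sharply, so this parallelogram bound stands in for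
  Minkowski's inequality throughout.\<close>
lemma energy_add_le:
  assumes [measurable]: "f \<in> borel_measurable borel" "g \<in> borel_measurable borel"
  shows "energy (\<lambda>x. f x + g x) \<le> 2 * energy f + 2 * energy g"
proof -
  have "energy (\<lambda>x. f x + g x) \<le> (\<integral>\<^sup>+x. 2 * ennreal ((cmod (f x))\<^sup>2) + 2 * ennreal ((cmod (g x))\<^sup>2) \<partial>lborel)"
    unfolding energy_def
    by (intro nn_integral_mono)
       (use cmod_add_square_le in \<open>simp add: ennreal_numeral[symmetric] ennreal_mult[symmetric] ennreal_plus[symmetric]
          del: ennreal_numeral ennreal_plus\<close>)
  also have "\<dots> = 2 * energy f + 2 * energy g"
    by (simp add: energy_def nn_integral_add nn_integral_cmult)
  finally show ?thesis .
qed

lemma energy_minus_commute: "energy (\<lambda>x. f x - g x) = energy (\<lambda>x. g x - f x)"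
  by (simp add: energy_def norm_minus_commute)

lemma L2_diff:
  assumes "f \<in> L2" "g \<in> L2"
  shows "(\<lambda>x. f x - g x) \<in> L2"
proof -
  have [measurable]: "f \<in> borel_measurable borel" "g \<in> borel_measurable borel"
    using assms L2_measurable by auto
  have "energy (\<lambda>x. f x + - g x) \<le> 2 * energy f + 2 * energy (\<lambda>x. - g x)"
    by (intro energy_add_le) auto
  also have "\<dots> < \<infinity>"
    using assms by (auto simp: L2_iff_energy energy_def ennreal_mult_less_top ennreal_add_eq_top less_top[symmetric] ennreal_mult_eq_top_iff)
  finally show ?thesis by (simp add: L2_iff_energy)
qed

lemma has_L2_limit_iff_energy:
  "F has_L2_limit f \<longleftrightarrow> (\<forall>R. F R \<in> L2) \<and> f \<in> L2 \<and> ((\<lambda>R. energy (\<lambda>x. F R x - f x)) \<longlongrightarrow> 0) at_top"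
proof -
  have "((\<lambda>R. L2norm (\<lambda>x. F R x - f x)) \<longlongrightarrow> 0) at_top
     \<longleftrightarrow> ((\<lambda>R. energy (\<lambda>x. F R x - f x)) \<longlongrightarrow> 0) at_top" if "\<forall>R. F R \<in> L2" "f \<in> L2"
  proof -
    have "energy (\<lambda>x. F R x - f x) = ennreal ((L2norm (\<lambda>x. F R x - f x))\<^sup>2)" for R
      using that by (intro energy_eq_L2norm L2_diff) auto
    then have "((\<lambda>R. energy (\<lambda>x. F R x - f x)) \<longlongrightarrow> 0) at_top
       \<longleftrightarrow> ((\<lambda>R. (L2norm (\<lambda>x. F R x - f x))\<^sup>2) \<longlongrightarrow> 0) at_top"
      using tendsto_ennreal_iff[of "\<lambda>R. (L2norm (\<lambda>x. F R x - f x))\<^sup>2" at_top 0] by simp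
    also have "\<dots> \<longleftrightarrow> ((\<lambda>R. L2norm (\<lambda>x. F R x - f x)) \<longlongrightarrow> 0) at_top"
    proof
      assume "((\<lambda>R. (L2norm (\<lambda>x. F R x - f x))\<^sup>2) \<longlongrightarrow> 0) at_top"
      from tendsto_real_sqrt[OF this] show "((\<lambda>R. L2norm (\<lambda>x. F R x - f x)) \<longlongrightarrow> 0) at_top" by simp
    next
      assume "((\<lambda>R. L2norm (\<lambda>x. F R x - f x)) \<longlongrightarrow> 0) at_top"
      from tendsto_power[OF this, of 2] show "((\<lambda>R. (L2norm (\<lambda>x. F R x - f x))\<^sup>2) \<longlongrightarrow> 0) at_top" by simp
    qed
    finally show ?thesis by simp
  qed
  then show ?thesis by (auto simp: has_L2_limit_def)
qed

text \<open>The Riesz--Fischer argument for families indexed by a real parameter. Along a sequence \<open>s k\<close> whose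
  consecutive differences \<open>d k\<close> have energy at most $4^{-k}$, the sum $\sum_k 2^k |d_k|^2$ has finite
  integral, hence is finite almost everywhere; $2|d_k| \le 2^{-k} + 2^k |d_k|^2$ then makes
  $\sum_k d_k$ converge absolutely there. Fatou's lemma upgrades the pointwise limit to an $L^2$
  limit of the whole family.\<close>
lemma L2_complete:
  fixes F :: "real \<Rightarrow> 'a::euclidean_space \<Rightarrow> complex"
  assumes F: "\<And>R. F R \<in> L2"
  assumes cauchy: "\<And>e. e > 0 \<Longrightarrow> \<exists>R0. \<forall>R\<ge>R0. \<forall>S\<ge>R0. energy (\<lambda>x. F R x - F S x) \<le> ennreal e"
  shows "\<exists>u. F has_L2_limit u"
proof -
  have [measurable]: "F R \<in> borel_measurable borel" for R
    using F L2_measurable by auto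
  have "\<exists>R0. \<forall>R\<ge>R0. \<forall>S\<ge>R0. energy (\<lambda>x. F R x - F S x) \<le> ennreal ((1/4) ^ k)" for k :: nat
    by (intro cauchy) simp
  then obtain r :: "nat \<Rightarrow> real" where r: "\<And>k R S. R \<ge> r k \<Longrightarrow> S \<ge> r k \<Longrightarrow> energy (\<lambda>x. F R x - F S x) \<le> ennreal ((1/4) ^ k)"
    by metis
  \<comment> \<open>The partial sums make the thresholds monotone, so that \<open>s j\<close> is beyond \<open>r k\<close> for all \<open>j \<ge> k\<close>.\<close>
  define s where "s k = (\<Sum>i\<le>k. \<bar>r i\<bar>)" for k
  have s: "r k \<le> s j" if "k \<le> j" for k j
  proof -
    have "\<bar>r k\<bar> \<le> s j" unfolding s_def using that by (intro member_le_sum) auto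
    then show ?thesis by linarith
  qed
  define d where "d k x = F (s (Suc k)) x - F (s k) x" for k x
  have [measurable]: "d k \<in> borel_measurable borel" for k
    unfolding d_def[abs_def] by measurable
  have "(\<integral>\<^sup>+x. (\<Sum>k. ennreal (2 ^ k * (cmod (d k x))\<^sup>2)) \<partial>lborel) = (\<Sum>k. ennreal (2 ^ k) * energy (d k))"
    by (simp add: nn_integral_suminf energy_def nn_integral_cmult ennreal_mult)
  also have "\<dots> \<le> (\<Sum>k. ennreal ((1/2) ^ k))"
  proof (intro suminf_le allI)
    fix k
    have "energy (d k) \<le> ennreal ((1/4) ^ k)"
      unfolding d_def[abs_def] by (intro r s) auto
    then have "ennreal (2 ^ k) * energy (d k) \<le> ennreal (2 ^ k) * ennreal ((1/4) ^ k)"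
      by (intro mult_left_mono) auto
    also have "\<dots> = ennreal ((1/2) ^ k)"
      by (simp add: ennreal_mult[symmetric] power_mult_distrib[symmetric] del: ennreal_power)
    finally show "ennreal (2 ^ k) * energy (d k) \<le> ennreal ((1/2) ^ k)" .
  qed auto
  also have "\<dots> = ennreal (\<Sum>k. (1/2) ^ k)"
    by (intro suminf_ennreal2 summable_geometric) auto
  finally have "(\<integral>\<^sup>+x. (\<Sum>k. ennreal (2 ^ k * (cmod (d k x))\<^sup>2)) \<partial>lborel) \<noteq> \<infinity>"
    by (auto simp: top_unique)
  then have "AE x in lborel. (\<Sum>k. ennreal (2 ^ k * (cmod (d k x))\<^sup>2)) \<noteq> \<infinity>"
    by (intro nn_integral_noteq_infinite) auto
  then have conv: "AE x in lborel. (\<lambda>k. F (s k) x) \<longlonglongrightarrow> lim (\<lambda>k. F (s k) x)"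
  proof eventually_elim
    case (elim x)
    then have sq: "summable (\<lambda>k. 2 ^ k * (cmod (d k x))\<^sup>2)"
      by (intro summable_suminf_not_top) auto
    have "summable (\<lambda>k. ((1/2) ^ k + 2 ^ k * (cmod (d k x))\<^sup>2) / 2)"
      by (intro summable_divide summable_add summable_geometric sq) auto
    then have "summable (\<lambda>k. d k x)"
    proof (rule summable_comparison_test[rotated], intro exI allI impI)
      fix k
      have "0 \<le> (1/2) ^ k * (1 - 2 ^ k * cmod (d k x))\<^sup>2" by simp
      also have "\<dots> = (1/2) ^ k + 2 ^ k * (cmod (d k x))\<^sup>2 - 2 * cmod (d k x)"
        by (simp add: power2_eq_square field_simps)
      finally show "cmod (d k x) \<le> ((1/2) ^ k + 2 ^ k * (cmod (d k x))\<^sup>2) / 2" by simp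
    qed
    then have "(\<lambda>n. \<Sum>k<n. d k x) \<longlonglongrightarrow> (\<Sum>k. d k x)"
      by (rule summable_LIMSEQ)
    then have "(\<lambda>n. F (s n) x - F (s 0) x) \<longlonglongrightarrow> (\<Sum>k. d k x)"
      by (simp add: d_def sum_lessThan_telescope[of "\<lambda>k. F (s k) x"])
    from tendsto_add[OF this tendsto_const[of "F (s 0) x"]] have "convergent (\<lambda>n. F (s n) x)"
      by (auto simp: convergent_def)
    then show ?case by (simp add: convergent_LIMSEQ_iff)
  qed
  define u where "u x = lim (\<lambda>k. F (s k) x)" for x
  have [measurable]: "u \<in> borel_measurable borel"
    unfolding u_def[abs_def] by measurable
  have est: "energy (\<lambda>x. F R x - u x) \<le> ennreal ((1/4) ^ j)" if "R \<ge> r j" for R j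
  proof -
    have "energy (\<lambda>x. F R x - u x) = (\<integral>\<^sup>+x. liminf (\<lambda>k. ennreal ((cmod (F R x - F (s k) x))\<^sup>2)) \<partial>lborel)"
      unfolding energy_def
    proof (intro nn_integral_cong_AE)
      show "AE x in lborel. ennreal ((cmod (F R x - u x))\<^sup>2) = liminf (\<lambda>k. ennreal ((cmod (F R x - F (s k) x))\<^sup>2))"
        using conv
      proof eventually_elim
        case (elim x)
        then have "(\<lambda>k. ennreal ((cmod (F R x - F (s k) x))\<^sup>2)) \<longlonglongrightarrow> ennreal ((cmod (F R x - u x))\<^sup>2)"
          unfolding u_def by (intro tendsto_intros)
        then show ?case by (intro lim_imp_Liminf[symmetric]) auto
      qed
    qed
    also have "\<dots> \<le> liminf (\<lambda>k. energy (\<lambda>x. F R x - F (s k) x))"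
      unfolding energy_def by (intro nn_integral_liminf) auto
    also have "\<dots> \<le> ennreal ((1/4) ^ j)"
    proof (rule Liminf_le)
      show "\<forall>\<^sub>F k in sequentially. energy (\<lambda>x. F R x - F (s k) x) \<le> ennreal ((1/4) ^ j)"
        using eventually_ge_at_top[of j] by eventually_elim (intro r that s)
    qed simp
    finally show ?thesis .
  qed
  have "u \<in> L2"
  proof -
    have "(\<lambda>x. F (r 0) x - u x) \<in> L2"
      using est[of 0 "r 0"] by (auto simp: L2_iff_energy intro: le_less_trans)
    from L2_diff[OF F[of "r 0"] this] show ?thesis by simp
  qed
  moreover have "((\<lambda>R. energy (\<lambda>x. F R x - u x)) \<longlongrightarrow> 0) at_top"
  proof (rule order_tendstoI)
    fix a :: ennreal assume "0 < a"
    have "(\<lambda>j. ennreal ((1/4) ^ j)) \<longlonglongrightarrow> ennreal 0"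
      by (intro tendsto_ennrealI LIMSEQ_realpow_zero) auto
    then have "\<forall>\<^sub>F j in sequentially. ennreal ((1/4) ^ j) < a"
      using \<open>0 < a\<close> by (auto dest: order_tendstoD)
    then obtain j where j: "ennreal ((1/4) ^ j) < a" by (auto simp: eventually_sequentially)
    show "\<forall>\<^sub>F R in at_top. energy (\<lambda>x. F R x - u x) < a"
      using eventually_ge_at_top[of "r j"] by eventually_elim (use est j in \<open>blast intro: le_less_trans\<close>)
  qed simp
  ultimately show ?thesis using F by (auto simp: has_L2_limit_iff_energy)
qed

lemma energy_mono: "(\<And>x. cmod (f x) \<le> cmod (g x)) \<Longrightarrow> energy f \<le> energy g"
  unfolding energy_def by (intro nn_integral_mono ennreal_leI power_mono) auto

lemma measurable_mem_cball [measurable]: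
  "Measurable.pred borel (\<lambda>x. x \<in> cball (a :: 'a::euclidean_space) r)"
  by simp

lemma truncation_has_L2_limit:
  fixes h :: "'a::euclidean_space \<Rightarrow> complex"
  assumes h: "h \<in> L2"
  shows "(\<lambda>R x. indicator (cball 0 R) x *\<^sub>R h x) has_L2_limit h"
  unfolding has_L2_limit_iff_energy
proof (intro conjI allI h)
  have [measurable]: "h \<in> borel_measurable borel" using h L2_measurable by auto
  have fin: "energy h < \<infinity>" using h by (simp add: L2_iff_energy)
  show "(\<lambda>x. indicator (cball 0 R) x *\<^sub>R h x) \<in> L2" for R
  proof -
    have "energy (\<lambda>x. indicator (cball 0 R) x *\<^sub>R h x) \<le> energy h"
      by (intro energy_mono) (auto simp: indicator_def)
    moreover have "(\<lambda>x. indicator (cball 0 R) x *\<^sub>R h x) \<in> borel_measurable borel"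
      by measurable
    ultimately show ?thesis using fin by (auto simp: L2_iff_energy intro: le_less_trans)
  qed
  have "((\<lambda>R. LINT x|lborel. (cmod (indicator (cball 0 R) x *\<^sub>R h x - h x))\<^sup>2) \<longlongrightarrow> (LINT x|(lborel::'a measure). 0)) at_top"
  proof (rule integral_dominated_convergence_at_top)
    show "integrable lborel (\<lambda>x. (cmod (h x))\<^sup>2)" using h by (simp add: L2_def)
    show "\<forall>\<^sub>F R in at_top. AE x in lborel. norm ((cmod (indicator (cball 0 R) x *\<^sub>R h x - h x))\<^sup>2) \<le> (cmod (h x))\<^sup>2"
      by (intro always_eventually allI AE_I2) (auto simp: indicator_def)
    show "AE x in lborel. ((\<lambda>R. (cmod (indicator (cball 0 R) x *\<^sub>R h x - h x))\<^sup>2) \<longlongrightarrow> 0) at_top"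
    proof (intro AE_I2 tendsto_eventually)
      fix x :: 'a
      show "\<forall>\<^sub>F R in at_top. (cmod (indicator (cball 0 R) x *\<^sub>R h x - h x))\<^sup>2 = 0"
        using eventually_ge_at_top[of "norm x"] by eventually_elim auto
    qed
    show "(\<lambda>x. (cmod (indicator (cball 0 R) x *\<^sub>R h x - h x))\<^sup>2) \<in> borel_measurable lborel" for R
      by measurable
  qed simp
  then have "((\<lambda>R. ennreal (LINT x|lborel. (cmod (indicator (cball 0 R) x *\<^sub>R h x - h x))\<^sup>2)) \<longlongrightarrow> ennreal 0) at_top"
    by (intro tendsto_ennrealI) simp
  moreover have "energy (\<lambda>x. indicator (cball 0 R) x *\<^sub>R h x - h x)
      = ennreal (LINT x|lborel. (cmod (indicator (cball 0 R) x *\<^sub>R h x - h x))\<^sup>2)" for R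
    unfolding energy_def
  proof (intro nn_integral_eq_integral)
    show "integrable lborel (\<lambda>x. (cmod (indicator (cball 0 R) x *\<^sub>R h x - h x))\<^sup>2)"
      by (rule Bochner_Integration.integrable_bound[of _ "\<lambda>x. (cmod (h x))\<^sup>2"])
         (use h in \<open>auto simp: L2_def indicator_def\<close>)
  qed auto
  ultimately show "((\<lambda>R. energy (\<lambda>x. indicator (cball 0 R) x *\<^sub>R h x - h x)) \<longlongrightarrow> 0) at_top"
    by simp
qed

text \<open>Any limit inherits a uniform bound on the family. This is what transfers estimates to
  \<^const>\<open>fourier_L2\<close>, which is only known to be some limit of its truncations.\<close>
lemma L2_limit_energy_le:
  assumes F: "F has_L2_limit u" and bound: "\<And>R. energy (F R) \<le> c"
  shows "energy u \<le> 2 * c"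
proof -
  have [measurable]: "u \<in> borel_measurable borel" "F R \<in> borel_measurable borel" for R
    using F by (auto simp: has_L2_limit_def L2_measurable)
  have "energy u \<le> 2 * energy (\<lambda>x. F R x - u x) + 2 * c" for R
  proof -
    have "energy u \<le> 2 * energy (\<lambda>x. u x - F R x) + 2 * energy (F R)"
      using energy_add_le[of "\<lambda>x. u x - F R x" "F R"] by simp
    also have "\<dots> \<le> 2 * energy (\<lambda>x. F R x - u x) + 2 * c"
      unfolding energy_minus_commute[of u] by (intro add_mono mult_left_mono bound) auto
    finally show ?thesis .
  qed
  moreover have "((\<lambda>R. 2 * energy (\<lambda>x. F R x - u x) + 2 * c) \<longlongrightarrow> 2 * 0 + 2 * c) at_top"
    using F by (intro tendsto_add tendsto_const ennreal_tendsto_cmult) (auto simp: has_L2_limit_iff_energy)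
  ultimately show ?thesis
    by (intro tendsto_lowerbound[where F="at_top :: real filter"]) (auto intro: always_eventually)
qed

section \<open>Gaussians on Euclidean spaces\<close>

definition gauss :: "real \<Rightarrow> 'b::euclidean_space \<Rightarrow> real" where
  "gauss \<sigma> \<tau> = exp (- (norm \<tau>)\<^sup>2 / (2 * \<sigma>\<^sup>2))"

lemma gauss_measurable [measurable]: "gauss \<sigma> \<in> borel_measurable borel"
  unfolding gauss_def[abs_def] by measurable

lemma gauss_nonneg [simp]: "0 \<le> gauss \<sigma> \<tau>"
  by (simp add: gauss_def)

lemma gauss_uminus [simp]: "gauss \<sigma> (- \<tau>) = gauss \<sigma> \<tau>"
  by (simp add: gauss_def)

text \<open>The product form reduces the Fourier transform on a Euclidean space to one dimension.\<close>
lemma gauss_eq_prod: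
  "gauss \<sigma> \<tau> = (\<Prod>b\<in>Basis. gauss \<sigma> (\<tau> \<bullet> b))"
  by (simp add: gauss_def exp_sum[symmetric] sum_divide_distrib[symmetric] sum_negf
      power2_norm_eq_inner euclidean_inner[of \<tau> \<tau>] flip: power2_eq_square)

text \<open>This is the characteristic function of the standard normal distribution, rescaled by \<open>\<sigma>\<close>.\<close>
lemma has_integral_gauss_exp_real:
  fixes z :: real
  assumes "\<sigma> > 0"
  shows "has_bochner_integral lborel (\<lambda>t. gauss \<sigma> t *\<^sub>R exp (\<i> * of_real (t * z)))
           (of_real (sqrt (2 * pi) * \<sigma> * gauss (1 / \<sigma>) z))"
proof -
  have int: "integrable lborel (\<lambda>x. std_normal_density x *\<^sub>R exp (\<i> * of_real (x * s)))" for s :: real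
    by (rule Bochner_Integration.integrable_bound[OF integrable_normal_density[of 1 0]])
       auto
  have "(LINT x|lborel. std_normal_density x *\<^sub>R exp (\<i> * of_real (x * s)))
          = complex_of_real (exp (- s\<^sup>2 / 2))" for s :: real
    using char_std_normal_distribution
    by (auto simp: char_def fun_eq_iff integral_density mult.commute)
  with int have std: "has_bochner_integral lborel (\<lambda>x. std_normal_density x *\<^sub>R exp (\<i> * of_real (x * s)))
          (of_real (exp (- s\<^sup>2 / 2)))" for s :: real
    by (simp add: has_bochner_integral_iff)
  show ?thesis
    using has_bochner_integral_mult_right[OF lborel_has_bochner_integral_real_affine_iff[of "1/\<sigma>" _ _ 0, THEN iffD1, OF _ std[of "\<sigma> * z"]], of "of_real (sqrt (2 * pi))"] assms
    by (simp add: std_normal_density_def gauss_def power_divide power_mult_distrib scaleR_conv_of_real mult_ac)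
qed

lemma has_integral_gauss_exp:
  fixes z :: "'b::euclidean_space"
  assumes "\<sigma> > 0"
  shows "has_bochner_integral lborel (\<lambda>\<tau>. gauss \<sigma> \<tau> *\<^sub>R exp (\<i> * of_real (\<tau> \<bullet> z)))
           (of_real ((sqrt (2 * pi) * \<sigma>) ^ DIM('b) * gauss (1 / \<sigma>) z))"
proof -
  interpret product_sigma_finite "\<lambda>_::'b. lborel :: real measure" ..
  define e where "e b t = gauss \<sigma> t *\<^sub>R exp (\<i> * of_real (t * (z \<bullet> b)))" for b :: 'b and t :: real
  have e: "integrable lborel (e b)"
     "integral\<^sup>L lborel (e b) = of_real (sqrt (2 * pi) * \<sigma> * gauss (1 / \<sigma>) (z \<bullet> b))" for b
    using has_integral_gauss_exp_real[OF assms, of "z \<bullet> b"]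
    by (simp_all add: has_bochner_integral_iff e_def[abs_def])
  have [measurable]: "e b \<in> borel_measurable borel" for b
    unfolding e_def[abs_def] by measurable
  have split: "gauss \<sigma> \<tau> *\<^sub>R exp (\<i> * of_real (\<tau> \<bullet> z)) = (\<Prod>b\<in>Basis. e b (\<tau> \<bullet> b))" for \<tau>
    by (simp add: e_def gauss_eq_prod[of _ \<tau>] euclidean_inner[of \<tau> z] exp_sum sum_distrib_left
        scaleR_conv_of_real prod.distrib)
  have coord: "(\<Prod>b\<in>Basis. e b ((\<Sum>b'\<in>Basis. f b' *\<^sub>R b') \<bullet> b)) = (\<Prod>b\<in>Basis. e b (f b))" for f
    by (intro prod.cong) simp_all
  have "integrable (\<Pi>\<^sub>M b\<in>(Basis::'b set). lborel) (\<lambda>f. \<Prod>b\<in>Basis. e b (f b))"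
    by (intro product_integrable_prod e) simp
  moreover have "(LINT f|(\<Pi>\<^sub>M b\<in>(Basis::'b set). lborel). (\<Prod>b\<in>Basis. e b (f b)))
     = of_real ((sqrt (2 * pi) * \<sigma>) ^ DIM('b) * gauss (1 / \<sigma>) z)"
    by (subst product_integral_prod) (simp_all add: e prod.distrib gauss_eq_prod[of _ z])
  ultimately show ?thesis
    unfolding split has_bochner_integral_iff
    by (subst (1 2) lborel_eq) (simp add: integrable_distr_eq integral_distr coord)
qed

lemma integrable_gauss: "\<sigma> > 0 \<Longrightarrow> integrable lborel (gauss \<sigma> :: 'b::euclidean_space \<Rightarrow> real)"
  using has_integral_gauss_exp[of \<sigma> "0::'b"]
  by (auto simp: has_bochner_integral_iff complex_of_real_integrable_eq scaleR_conv_of_real)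

text \<open>Used with \<open>1 / \<sigma>\<close> in place of \<open>\<sigma>\<close>: the transform of \<open>gauss \<sigma>\<close> then has total mass
  $(2\pi)^n$ whatever \<open>\<sigma>\<close> is, which makes the bounds below uniform in the regularisation.\<close>
lemma nn_integral_gauss:
  fixes a :: "'b::euclidean_space"
  assumes "\<sigma> > 0"
  shows "(\<integral>\<^sup>+\<tau>. ennreal (gauss \<sigma> (\<tau> - a)) \<partial>lborel) = ennreal ((sqrt (2 * pi) * \<sigma>) ^ DIM('b))"
proof -
  have "(\<integral>\<^sup>+\<tau>. ennreal (gauss \<sigma> (\<tau> - a)) \<partial>lborel) = (\<integral>\<^sup>+\<tau>. ennreal (gauss \<sigma> \<tau>) \<partial>distr lborel borel ((+) (- a)))"
    by (simp add: nn_integral_distr)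
  also have "\<dots> = (\<integral>\<^sup>+\<tau>. ennreal (gauss \<sigma> (\<tau>::'b)) \<partial>lborel)"
    by (simp add: lborel_distr_plus)
  also have "\<dots> = ennreal (LINT \<tau>|lborel. gauss \<sigma> (\<tau>::'b))"
    by (intro nn_integral_eq_integral integrable_gauss assms) simp
  also have "(LINT \<tau>|lborel. gauss \<sigma> (\<tau>::'b)) = (sqrt (2 * pi) * \<sigma>) ^ DIM('b)"
  proof -
    have "complex_of_real (LINT \<tau>|lborel. gauss \<sigma> (\<tau>::'b)) = of_real ((sqrt (2 * pi) * \<sigma>) ^ DIM('b))"
      using has_integral_gauss_exp[OF assms, of "0::'b"]
      by (simp add: has_bochner_integral_iff scaleR_conv_of_real gauss_def[of _ 0])
    then show ?thesis by (simp only: of_real_eq_iff)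
  qed
  finally show ?thesis .
qed

lemma integral_norm_bound_ennreal':
  fixes f :: "'c \<Rightarrow> 'd::{banach, second_countable_topology}"
  shows "ennreal (norm (integral\<^sup>L M f)) \<le> (\<integral>\<^sup>+x. ennreal (norm (f x)) \<partial>M)"
  by (cases "integrable M f") (simp_all add: integral_norm_bound_ennreal not_integrable_integral_eq)

section \<open>Oscillatory transforms with a Jacobian weight\<close>

text \<open>The assumption \<open>pushforward_le\<close> says that \<open>\<Phi>\<close> pushes the measure $w(\xi)\,d\xi$ forward to a measure
  dominated by \<open>B\<close> times Lebesgue measure. It holds when \<open>w\<close> is the Jacobian of \<open>\<Phi>\<close> and \<open>\<Phi>\<close> is at
  most \<open>B\<close>-to-one, and is the only trace of a change of variables $s = \Phi(\xi)$ that the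
  $L^2$ bound uses. Local finiteness of \<open>w\<close> makes the transform of $\sqrt w\, h$ absolutely
  convergent for $h \in L^2$ cut off to a ball.\<close>
locale weighted_phase =
  fixes \<Phi> :: "'a::euclidean_space \<Rightarrow> 'b::euclidean_space" and w :: "'a \<Rightarrow> real" and B :: real
  assumes phase_measurable [measurable]: "\<Phi> \<in> borel_measurable borel"
    and weight_measurable [measurable]: "w \<in> borel_measurable borel"
    and weight_nonneg: "\<And>\<xi>. 0 \<le> w \<xi>"
    and B_nonneg: "0 \<le> B"
    and pushforward_le: "\<And>F. F \<in> borel_measurable borel \<Longrightarrow>
          (\<integral>\<^sup>+\<xi>. F (\<Phi> \<xi>) * ennreal (w \<xi>) \<partial>lborel) \<le> ennreal B * (\<integral>\<^sup>+s. F s \<partial>lborel)"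
    and weight_locally_finite: "\<And>R. (\<integral>\<^sup>+\<xi>. ennreal (w \<xi>) * indicator (cball 0 R) \<xi> \<partial>lborel) < \<infinity>"
begin

definition osc :: "('a \<Rightarrow> complex) \<Rightarrow> 'b \<Rightarrow> complex" where
  "osc f \<tau> = (LINT \<xi>|lborel. exp (\<i> * of_real (\<tau> \<bullet> \<Phi> \<xi>)) * f \<xi>)"

lemma osc_measurable [measurable]:
  assumes [measurable]: "f \<in> borel_measurable borel"
  shows "osc f \<in> borel_measurable borel"
  unfolding osc_def[abs_def] by measurable

lemma integrable_osc_kernel:
  assumes "integrable lborel f"
  shows "integrable lborel (\<lambda>\<xi>. exp (\<i> * of_real (\<tau> \<bullet> \<Phi> \<xi>)) * f \<xi>)"
proof (rule Bochner_Integration.integrable_bound[OF assms])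
  show "(\<lambda>\<xi>. exp (\<i> * of_real (\<tau> \<bullet> \<Phi> \<xi>)) * f \<xi>) \<in> borel_measurable lborel"
    using borel_measurable_integrable[OF assms] by measurable
qed (simp add: norm_mult)

lemma norm_osc_le:
  "norm (osc f \<tau>) \<le> (LINT \<xi>|lborel. norm (f \<xi>))"
  unfolding osc_def by (rule order_trans[OF integral_norm_bound]) (simp add: norm_mult)

text \<open>Fubini in the form of a multiplication formula: the transform can be moved to the other factor.\<close>
lemma integral_mult_osc:
  assumes k: "integrable lborel k" and f: "integrable lborel f"
  shows "(LINT \<tau>|lborel. k \<tau> * osc f \<tau>)
       = (LINT \<xi>|lborel. f \<xi> * (LINT \<tau>|lborel. k \<tau> * exp (\<i> * of_real (\<tau> \<bullet> \<Phi> \<xi>))))"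
proof -
  have [measurable]: "k \<in> borel_measurable borel" "f \<in> borel_measurable borel"
    using assms by auto
  have "integrable (lborel \<Otimes>\<^sub>M lborel) (\<lambda>(\<xi>, \<tau>). k \<tau> * (exp (\<i> * of_real (\<tau> \<bullet> \<Phi> \<xi>)) * f \<xi>))"
  proof (rule integrableI_bounded)
    have "(\<integral>\<^sup>+ z. ennreal (norm (case z of (\<xi>, \<tau>) \<Rightarrow> k \<tau> * (exp (\<i> * of_real (\<tau> \<bullet> \<Phi> \<xi>)) * f \<xi>))) \<partial>(lborel \<Otimes>\<^sub>M lborel))
        = (\<integral>\<^sup>+ \<xi>. \<integral>\<^sup>+ \<tau>. ennreal (norm (f \<xi>)) * ennreal (norm (k \<tau>)) \<partial>lborel \<partial>lborel)"
      by (subst lborel.nn_integral_fst[symmetric]) (auto simp: norm_mult ennreal_mult mult_ac)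
    also have "\<dots> = (\<integral>\<^sup>+ \<xi>. ennreal (norm (f \<xi>)) \<partial>lborel) * (\<integral>\<^sup>+ \<tau>. ennreal (norm (k \<tau>)) \<partial>lborel)"
      by (simp add: nn_integral_cmult nn_integral_multc)
    also have "\<dots> < \<infinity>"
      using k f by (simp add: integrable_iff_bounded ennreal_mult_less_top)
    finally show "(\<integral>\<^sup>+ z. ennreal (norm (case z of (\<xi>, \<tau>) \<Rightarrow> k \<tau> * (exp (\<i> * of_real (\<tau> \<bullet> \<Phi> \<xi>)) * f \<xi>))) \<partial>(lborel \<Otimes>\<^sub>M lborel)) < \<infinity>" .
  qed measurable
  then have "(LINT \<tau>|lborel. LINT \<xi>|lborel. k \<tau> * (exp (\<i> * of_real (\<tau> \<bullet> \<Phi> \<xi>)) * f \<xi>))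
      = (LINT \<xi>|lborel. LINT \<tau>|lborel. k \<tau> * (exp (\<i> * of_real (\<tau> \<bullet> \<Phi> \<xi>)) * f \<xi>))"
    by (rule lborel_pair.Fubini_integral)
  also have "(\<lambda>\<xi>. LINT \<tau>|lborel. k \<tau> * (exp (\<i> * of_real (\<tau> \<bullet> \<Phi> \<xi>)) * f \<xi>))
     = (\<lambda>\<xi>. f \<xi> * (LINT \<tau>|lborel. k \<tau> * exp (\<i> * of_real (\<tau> \<bullet> \<Phi> \<xi>))))"
    by (subst integral_mult_right_zero[symmetric]) (simp add: mult_ac)
  finally show ?thesis by (simp add: osc_def)
qed

text \<open>The heart of the matter, a $TT^*$ argument. Put $f = \sqrt w\, h$. Two applications of the
  multiplication formula turn the left-hand side into
  $\iint f(\xi) \overline{f(\xi')} P(\Phi(\xi') - \Phi(\xi))\,d\xi'\,d\xi$ up to conjugation, where \<open>P\<close>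
  is the nonnegative transform of the Gaussian weight. Pairing the square roots crosswise,
  $$|f(\xi) f(\xi')| \le \tfrac12 \left( w(\xi) |h(\xi')|^2 + w(\xi') |h(\xi)|^2 \right),$$
  puts in each term the weight on one variable and \<open>h\<close> on the other. Integrating the weighted variable
  first, the pushforward bound leaves \<open>B\<close> times the total mass $(2\pi)^n$ of \<open>P\<close>.\<close>
lemma gauss_regularised_bound:
  fixes h :: "'a \<Rightarrow> complex"
  assumes [measurable]: "h \<in> borel_measurable borel"
    and f: "integrable lborel (\<lambda>\<xi>. of_real (sqrt (w \<xi>)) * h \<xi>)" and \<sigma>: "\<sigma> > 0"
  shows "(\<integral>\<^sup>+\<tau>. ennreal (gauss \<sigma> \<tau> * (cmod (osc (\<lambda>\<xi>. of_real (sqrt (w \<xi>)) * h \<xi>) \<tau>))\<^sup>2) \<partial>lborel)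
           \<le> ennreal (B * (2 * pi) ^ DIM('b)) * energy h"
proof -
  define f where "f \<xi> = of_real (sqrt (w \<xi>)) * h \<xi>" for \<xi>
  have f_int: "integrable lborel f"
    using f by (simp add: f_def[abs_def])
  have [measurable]: "f \<in> borel_measurable borel"
    unfolding f_def[abs_def] by measurable
  define P where "P z = (sqrt (2 * pi) * \<sigma>) ^ DIM('b) * gauss (1 / \<sigma>) z" for z :: 'b
  have [measurable]: "P \<in> borel_measurable borel" unfolding P_def[abs_def] by measurable
  have P_nonneg: "0 \<le> P z" for z using \<sigma> by (simp add: P_def)
  have P_sym: "P (a - b) = P (b - a)" for a b
    using gauss_uminus[of "1 / \<sigma>" "a - b"] by (simp add: P_def)
  have P_int: "(\<integral>\<^sup>+s. ennreal (P (s - a)) \<partial>lborel) = ennreal ((2 * pi) ^ DIM('b))" for a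
  proof -
    have "(\<integral>\<^sup>+s. ennreal (P (s - a)) \<partial>lborel)
        = ennreal ((sqrt (2 * pi) * \<sigma>) ^ DIM('b)) * ennreal ((sqrt (2 * pi) * (1 / \<sigma>)) ^ DIM('b))"
      using \<sigma> by (simp add: P_def ennreal_mult nn_integral_cmult nn_integral_gauss)
    also have "\<dots> = ennreal (((sqrt (2 * pi) * \<sigma>) * (sqrt (2 * pi) * (1 / \<sigma>))) ^ DIM('b))"
      using \<sigma> by (subst power_mult_distrib, subst ennreal_mult) auto
    also have "(sqrt (2 * pi) * \<sigma>) * (sqrt (2 * pi) * (1 / \<sigma>)) = 2 * pi"
    proof -
      have "(sqrt (2 * pi) * \<sigma>) * (sqrt (2 * pi) * (1 / \<sigma>)) = (sqrt (2 * pi) * sqrt (2 * pi)) * (\<sigma> * (1 / \<sigma>))"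
        by (simp only: mult_ac)
      then show ?thesis using \<sigma> by simp
    qed
    finally show ?thesis .
  qed
  \<comment> \<open>Transforms of integrable functions are merely bounded; the Gaussian supplies integrability.\<close>
  have gauss_osc: "integrable lborel (\<lambda>\<tau>. of_real (gauss \<sigma> \<tau>) * c \<tau>)"
    if [measurable]: "c \<in> borel_measurable borel" and "\<And>\<tau>. norm (c \<tau>) \<le> M" for c :: "'b \<Rightarrow> complex" and M
  proof (rule Bochner_Integration.integrable_bound)
    show "integrable lborel (\<lambda>\<tau>::'b. M * gauss \<sigma> \<tau>)"
      by (intro integrable_mult_right integrable_gauss \<sigma>)
    show "AE \<tau> in lborel. norm (of_real (gauss \<sigma> \<tau>) * c \<tau>) \<le> norm (M * gauss \<sigma> \<tau>)"
    proof (intro AE_I2)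
      fix \<tau>
      have "gauss \<sigma> \<tau> * norm (c \<tau>) \<le> gauss \<sigma> \<tau> * \<bar>M\<bar>"
        using that(2)[of \<tau>] by (intro mult_left_mono) auto
      then show "norm (of_real (gauss \<sigma> \<tau>) * c \<tau>) \<le> norm (M * gauss \<sigma> \<tau>)"
        by (simp add: norm_mult abs_mult mult_ac)
    qed
  qed measurable
  have [measurable]: "cnj \<in> borel_measurable borel"
    by (intro borel_measurable_continuous_onI continuous_on_cnj continuous_on_id)
  \<comment> \<open>Integrating \<open>k * osc f\<close> gives the left-hand side; moving the transform onto \<open>k\<close> leaves \<open>A\<close>, whose
    conjugate contains a second transform of \<open>f\<close> to be moved in turn.\<close>
  define k where "k \<tau> = of_real (gauss \<sigma> \<tau>) * cnj (osc f \<tau>)" for \<tau>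
  have k_int: "integrable lborel k"
    unfolding k_def[abs_def] by (rule gauss_osc[where M="LINT \<xi>|lborel. norm (f \<xi>)"]) (simp_all add: norm_osc_le)
  have k_osc: "k \<tau> * osc f \<tau> = of_real (gauss \<sigma> \<tau>) * of_real ((cmod (osc f \<tau>))\<^sup>2)" for \<tau>
    by (simp only: k_def mult.assoc mult.commute[of "cnj _"] complex_norm_square)
  then have Re_k_osc: "Re (k \<tau> * osc f \<tau>) = gauss \<sigma> \<tau> * (cmod (osc f \<tau>))\<^sup>2" for \<tau>
    by (simp only: of_real_mult[symmetric] Re_complex_of_real)
  have k_osc_int: "integrable lborel (\<lambda>\<tau>. k \<tau> * osc f \<tau>)"
    unfolding k_osc
  proof (rule gauss_osc[where M="(LINT \<xi>|lborel. norm (f \<xi>))\<^sup>2"])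
    show "norm (complex_of_real ((cmod (osc f \<tau>))\<^sup>2)) \<le> (LINT \<xi>|lborel. norm (f \<xi>))\<^sup>2" for \<tau>
      by (simp add: norm_power power_mono norm_osc_le)
  qed measurable
  define A where "A \<xi> = (LINT \<tau>|lborel. k \<tau> * exp (\<i> * of_real (\<tau> \<bullet> \<Phi> \<xi>)))" for \<xi>
  have cnj_A: "cnj (A \<xi>) = (LINT \<xi>'|lborel. f \<xi>' * of_real (P (\<Phi> \<xi>' - \<Phi> \<xi>)))" for \<xi>
  proof -
    have "cnj (A \<xi>) = (LINT \<tau>|lborel. (of_real (gauss \<sigma> \<tau>) * exp (- (\<i> * of_real (\<tau> \<bullet> \<Phi> \<xi>)))) * osc f \<tau>)"
      unfolding A_def k_def by (subst Bochner_Integration.integral_cnj[symmetric]) (intro Bochner_Integration.integral_cong; simp add: exp_cnj mult_ac)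
    also have "\<dots> = (LINT \<xi>'|lborel. f \<xi>' * (LINT \<tau>|lborel. (of_real (gauss \<sigma> \<tau>) * exp (- (\<i> * of_real (\<tau> \<bullet> \<Phi> \<xi>))))
                 * exp (\<i> * of_real (\<tau> \<bullet> \<Phi> \<xi>'))))"
      by (intro integral_mult_osc gauss_osc[where M=1] f_int) (auto simp: norm_exp_eq_Re)
    also have "(\<lambda>\<xi>'. LINT \<tau>|lborel. (of_real (gauss \<sigma> \<tau>) * exp (- (\<i> * of_real (\<tau> \<bullet> \<Phi> \<xi>)))) * exp (\<i> * of_real (\<tau> \<bullet> \<Phi> \<xi>')))
       = (\<lambda>\<xi>'. of_real (P (\<Phi> \<xi>' - \<Phi> \<xi>)))"
    proof
      fix \<xi>'
      have "(LINT \<tau>|lborel. (of_real (gauss \<sigma> \<tau>) * exp (- (\<i> * of_real (\<tau> \<bullet> \<Phi> \<xi>)))) * exp (\<i> * of_real (\<tau> \<bullet> \<Phi> \<xi>')))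
          = (LINT \<tau>|lborel. gauss \<sigma> \<tau> *\<^sub>R exp (\<i> * of_real (\<tau> \<bullet> (\<Phi> \<xi>' - \<Phi> \<xi>))))"
        by (intro Bochner_Integration.integral_cong)
           (simp_all add: scaleR_conv_of_real exp_add[symmetric] mult.assoc inner_diff_right algebra_simps)
      also have "\<dots> = of_real (P (\<Phi> \<xi>' - \<Phi> \<xi>))"
        unfolding P_def by (rule has_bochner_integral_integral_eq[OF has_integral_gauss_exp[OF \<sigma>]])
      finally show "(LINT \<tau>|lborel. (of_real (gauss \<sigma> \<tau>) * exp (- (\<i> * of_real (\<tau> \<bullet> \<Phi> \<xi>)))) * exp (\<i> * of_real (\<tau> \<bullet> \<Phi> \<xi>')))
          = of_real (P (\<Phi> \<xi>' - \<Phi> \<xi>))" .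
    qed
    finally show ?thesis .
  qed
  have A_le: "ennreal (norm (A \<xi>)) \<le> (\<integral>\<^sup>+\<xi>'. ennreal (norm (f \<xi>') * P (\<Phi> \<xi>' - \<Phi> \<xi>)) \<partial>lborel)" for \<xi>
  proof -
    have "ennreal (norm (A \<xi>)) = ennreal (norm (cnj (A \<xi>)))" by simp
    also have "\<dots> \<le> (\<integral>\<^sup>+\<xi>'. ennreal (norm (f \<xi>' * of_real (P (\<Phi> \<xi>' - \<Phi> \<xi>)))) \<partial>lborel)"
      unfolding cnj_A by (rule integral_norm_bound_ennreal')
    finally show ?thesis using P_nonneg by (simp add: norm_mult)
  qed
  define I where "I = (\<integral>\<^sup>+\<xi>. \<integral>\<^sup>+\<xi>'. ennreal (w \<xi>' * (cmod (h \<xi>))\<^sup>2 * P (\<Phi> \<xi>' - \<Phi> \<xi>) / 2) \<partial>lborel \<partial>lborel)"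
  have I_le: "I \<le> ennreal (B * (2 * pi) ^ DIM('b) / 2) * energy h"
  proof -
    have "(\<integral>\<^sup>+\<xi>'. ennreal (w \<xi>' * (cmod (h \<xi>))\<^sup>2 * P (\<Phi> \<xi>' - \<Phi> \<xi>) / 2) \<partial>lborel)
        \<le> ennreal (B * (2 * pi) ^ DIM('b) / 2) * ennreal ((cmod (h \<xi>))\<^sup>2)" for \<xi>
    proof -
      have "(\<integral>\<^sup>+\<xi>'. ennreal (w \<xi>' * (cmod (h \<xi>))\<^sup>2 * P (\<Phi> \<xi>' - \<Phi> \<xi>) / 2) \<partial>lborel)
         = ennreal ((cmod (h \<xi>))\<^sup>2 / 2) * (\<integral>\<^sup>+\<xi>'. ennreal (P (\<Phi> \<xi>' - \<Phi> \<xi>)) * ennreal (w \<xi>') \<partial>lborel)"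
        using weight_nonneg P_nonneg
        by (subst nn_integral_cmult[symmetric]) (auto simp: ennreal_mult[symmetric] mult_ac)
      also have "\<dots> \<le> ennreal ((cmod (h \<xi>))\<^sup>2 / 2) * (ennreal B * (\<integral>\<^sup>+s. ennreal (P (s - \<Phi> \<xi>)) \<partial>lborel))"
        by (intro mult_left_mono pushforward_le[where F="\<lambda>s. ennreal (P (s - \<Phi> \<xi>))"]) auto
      also have "\<dots> = ennreal (B * (2 * pi) ^ DIM('b) / 2) * ennreal ((cmod (h \<xi>))\<^sup>2)"
        unfolding P_int using B_nonneg by (simp add: ennreal_mult[symmetric] mult_ac del: ennreal_power)
      finally show ?thesis .
    qed
    then have "I
       \<le> (\<integral>\<^sup>+\<xi>. ennreal (B * (2 * pi) ^ DIM('b) / 2) * ennreal ((cmod (h \<xi>))\<^sup>2) \<partial>lborel)"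
      unfolding I_def by (intro nn_integral_mono)
    also have "\<dots> = ennreal (B * (2 * pi) ^ DIM('b) / 2) * energy h"
      by (simp add: energy_def nn_integral_cmult)
    finally show ?thesis .
  qed
  have "(\<integral>\<^sup>+\<tau>. ennreal (gauss \<sigma> \<tau> * (cmod (osc f \<tau>))\<^sup>2) \<partial>lborel)
      = (\<integral>\<^sup>+\<tau>. ennreal (Re (k \<tau> * osc f \<tau>)) \<partial>lborel)"
    by (simp only: Re_k_osc)
  also have "\<dots> = ennreal (LINT \<tau>|lborel. Re (k \<tau> * osc f \<tau>))"
    by (intro nn_integral_eq_integral integrable_Re k_osc_int AE_I2) (simp only: Re_k_osc, simp)
  also have "\<dots> = ennreal (Re (LINT \<tau>|lborel. k \<tau> * osc f \<tau>))"
    by (simp only: integral_Re[OF k_osc_int])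
  also have "\<dots> \<le> ennreal (norm (LINT \<tau>|lborel. k \<tau> * osc f \<tau>))"
    by (intro ennreal_leI complex_Re_le_cmod)
  also have "\<dots> = ennreal (norm (LINT \<xi>|lborel. f \<xi> * A \<xi>))"
    unfolding A_def by (subst integral_mult_osc[OF k_int f_int]) simp
  also have "\<dots> \<le> (\<integral>\<^sup>+\<xi>. ennreal (norm (f \<xi> * A \<xi>)) \<partial>lborel)"
    by (rule integral_norm_bound_ennreal')
  also have "\<dots> \<le> (\<integral>\<^sup>+\<xi>. \<integral>\<^sup>+\<xi>'. ennreal (norm (f \<xi>) * norm (f \<xi>') * P (\<Phi> \<xi>' - \<Phi> \<xi>)) \<partial>lborel \<partial>lborel)"
  proof (intro nn_integral_mono)
    fix \<xi>
    have "ennreal (norm (f \<xi> * A \<xi>)) \<le> ennreal (norm (f \<xi>)) * (\<integral>\<^sup>+\<xi>'. ennreal (norm (f \<xi>') * P (\<Phi> \<xi>' - \<Phi> \<xi>)) \<partial>lborel)"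
      unfolding norm_mult ennreal_mult[OF norm_ge_zero norm_ge_zero] by (intro mult_left_mono A_le) simp
    also have "\<dots> = (\<integral>\<^sup>+\<xi>'. ennreal (norm (f \<xi>) * norm (f \<xi>') * P (\<Phi> \<xi>' - \<Phi> \<xi>)) \<partial>lborel)"
      using P_nonneg by (subst nn_integral_cmult[symmetric]) (auto simp: ennreal_mult mult.assoc)
    finally show "ennreal (norm (f \<xi> * A \<xi>)) \<le> (\<integral>\<^sup>+\<xi>'. ennreal (norm (f \<xi>) * norm (f \<xi>') * P (\<Phi> \<xi>' - \<Phi> \<xi>)) \<partial>lborel)" .
  qed
  also have "\<dots> \<le> (\<integral>\<^sup>+\<xi>. \<integral>\<^sup>+\<xi>'. (ennreal (w \<xi> * (cmod (h \<xi>'))\<^sup>2 * P (\<Phi> \<xi> - \<Phi> \<xi>') / 2)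
                           + ennreal (w \<xi>' * (cmod (h \<xi>))\<^sup>2 * P (\<Phi> \<xi>' - \<Phi> \<xi>) / 2)) \<partial>lborel \<partial>lborel)"
  proof (intro nn_integral_mono)
    fix \<xi> \<xi>'
    have "0 \<le> (sqrt (w \<xi>) * cmod (h \<xi>') - sqrt (w \<xi>') * cmod (h \<xi>))\<^sup>2" by simp
    then have "norm (f \<xi>) * norm (f \<xi>') \<le> w \<xi> * (cmod (h \<xi>'))\<^sup>2 / 2 + w \<xi>' * (cmod (h \<xi>))\<^sup>2 / 2"
      using weight_nonneg by (simp add: f_def norm_mult power2_diff power_mult_distrib algebra_simps)
    from mult_right_mono[OF this P_nonneg[of "\<Phi> \<xi>' - \<Phi> \<xi>"]]
    have "norm (f \<xi>) * norm (f \<xi>') * P (\<Phi> \<xi>' - \<Phi> \<xi>)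
        \<le> w \<xi> * (cmod (h \<xi>'))\<^sup>2 * P (\<Phi> \<xi>' - \<Phi> \<xi>) / 2 + w \<xi>' * (cmod (h \<xi>))\<^sup>2 * P (\<Phi> \<xi>' - \<Phi> \<xi>) / 2"
      by (simp add: distrib_right)
    from ennreal_leI[OF this] have "ennreal (norm (f \<xi>) * norm (f \<xi>') * P (\<Phi> \<xi>' - \<Phi> \<xi>))
        \<le> ennreal (w \<xi> * (cmod (h \<xi>'))\<^sup>2 * P (\<Phi> \<xi>' - \<Phi> \<xi>) / 2) + ennreal (w \<xi>' * (cmod (h \<xi>))\<^sup>2 * P (\<Phi> \<xi>' - \<Phi> \<xi>) / 2)"
      using weight_nonneg P_nonneg by (simp del: times_divide_eq_left)
    then show "ennreal (norm (f \<xi>) * norm (f \<xi>') * P (\<Phi> \<xi>' - \<Phi> \<xi>))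
        \<le> ennreal (w \<xi> * (cmod (h \<xi>'))\<^sup>2 * P (\<Phi> \<xi> - \<Phi> \<xi>') / 2) + ennreal (w \<xi>' * (cmod (h \<xi>))\<^sup>2 * P (\<Phi> \<xi>' - \<Phi> \<xi>) / 2)"
      unfolding P_sym[of "\<Phi> \<xi>" "\<Phi> \<xi>'"] .
  qed
  also have "\<dots> = (\<integral>\<^sup>+\<xi>. \<integral>\<^sup>+\<xi>'. ennreal (w \<xi> * (cmod (h \<xi>'))\<^sup>2 * P (\<Phi> \<xi> - \<Phi> \<xi>') / 2) \<partial>lborel \<partial>lborel) + I"
    by (simp add: nn_integral_add I_def)
  also have "(\<integral>\<^sup>+\<xi>. \<integral>\<^sup>+\<xi>'. ennreal (w \<xi> * (cmod (h \<xi>'))\<^sup>2 * P (\<Phi> \<xi> - \<Phi> \<xi>') / 2) \<partial>lborel \<partial>lborel) = I"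
    unfolding I_def by (rule lborel_pair.Fubini'[symmetric]) measurable
  also have "I + I \<le> ennreal (B * (2 * pi) ^ DIM('b) / 2) * energy h + ennreal (B * (2 * pi) ^ DIM('b) / 2) * energy h"
    by (intro add_mono I_le)
  also have "\<dots> = ennreal (B * (2 * pi) ^ DIM('b)) * energy h"
    using B_nonneg by (subst distrib_right[symmetric], subst ennreal_plus[symmetric]) (auto simp: mult_ac)
  finally show ?thesis unfolding f_def .
qed

text \<open>The Gaussian weights tend to 1 pointwise and the regularised bound does not depend on \<open>\<sigma>\<close>, so
  Fatou's lemma removes the weight. For $\Phi(\xi) = -\xi$ and $w = 1$ this is the Plancherel bound.\<close>
lemma osc_energy_le:
  fixes h :: "'a \<Rightarrow> complex"
  assumes [measurable]: "h \<in> borel_measurable borel"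
    and f: "integrable lborel (\<lambda>\<xi>. of_real (sqrt (w \<xi>)) * h \<xi>)"
  shows "energy (osc (\<lambda>\<xi>. of_real (sqrt (w \<xi>)) * h \<xi>)) \<le> ennreal (B * (2 * pi) ^ DIM('b)) * energy h"
proof -
  let ?u = "osc (\<lambda>\<xi>. of_real (sqrt (w \<xi>)) * h \<xi>)"
  have "(\<lambda>k. gauss (real (Suc k)) \<tau> * (cmod (?u \<tau>))\<^sup>2) \<longlonglongrightarrow> (cmod (?u \<tau>))\<^sup>2" for \<tau>
  proof -
    have "(\<lambda>k. exp (- (norm \<tau>)\<^sup>2 / 2 * (inverse (real (Suc k)))\<^sup>2) * (cmod (?u \<tau>))\<^sup>2)
            \<longlonglongrightarrow> exp (- (norm \<tau>)\<^sup>2 / 2 * 0\<^sup>2) * (cmod (?u \<tau>))\<^sup>2"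
      by (intro tendsto_intros LIMSEQ_inverse_real_of_nat)
    then show ?thesis by (simp add: gauss_def power_inverse divide_simps)
  qed
  then have lim: "liminf (\<lambda>k. ennreal (gauss (real (Suc k)) \<tau> * (cmod (?u \<tau>))\<^sup>2)) = ennreal ((cmod (?u \<tau>))\<^sup>2)" for \<tau>
    by (intro lim_imp_Liminf tendsto_ennrealI) auto
  have "energy ?u = (\<integral>\<^sup>+\<tau>. liminf (\<lambda>k. ennreal (gauss (real (Suc k)) \<tau> * (cmod (?u \<tau>))\<^sup>2)) \<partial>lborel)"
    by (simp only: energy_def lim)
  also have "\<dots> \<le> liminf (\<lambda>k. \<integral>\<^sup>+\<tau>. ennreal (gauss (real (Suc k)) \<tau> * (cmod (?u \<tau>))\<^sup>2) \<partial>lborel)"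
    by (intro nn_integral_liminf) measurable
  also have "\<dots> \<le> ennreal (B * (2 * pi) ^ DIM('b)) * energy h"
    by (intro Liminf_le always_eventually allI gauss_regularised_bound f) auto
  finally show ?thesis .
qed

lemma integrable_truncated:
  assumes h: "h \<in> L2"
  shows "integrable lborel (\<lambda>\<xi>. of_real (sqrt (w \<xi>)) * (indicator (cball 0 R) \<xi> *\<^sub>R h \<xi>))"
proof (rule integrableI_bounded)
  have [measurable]: "h \<in> borel_measurable borel" using h L2_measurable by auto
  show "(\<lambda>\<xi>. of_real (sqrt (w \<xi>)) * (indicator (cball 0 R) \<xi> *\<^sub>R h \<xi>)) \<in> borel_measurable lborel" by measurable
  have "ennreal (norm (of_real (sqrt (w \<xi>)) * (indicator (cball 0 R) \<xi> *\<^sub>R h \<xi>)))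
        \<le> ennreal (w \<xi>) * indicator (cball 0 R) \<xi> + ennreal ((cmod (h \<xi>))\<^sup>2)" for \<xi>
  proof (cases "\<xi> \<in> cball 0 R")
    case True
    have "0 \<le> (sqrt (w \<xi>) - cmod (h \<xi>))\<^sup>2" "0 \<le> sqrt (w \<xi>) * cmod (h \<xi>)" by (simp_all add: weight_nonneg)
    then have "sqrt (w \<xi>) * cmod (h \<xi>) \<le> w \<xi> + (cmod (h \<xi>))\<^sup>2"
      unfolding power2_diff real_sqrt_pow2[OF weight_nonneg] mult.assoc by linarith
    then have "ennreal (sqrt (w \<xi>) * cmod (h \<xi>)) \<le> ennreal (w \<xi> + (cmod (h \<xi>))\<^sup>2)"
      by (rule ennreal_leI)
    then show ?thesis using True weight_nonneg[of \<xi>] by (simp add: norm_mult)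
  qed (simp add: indicator_def)
  then have "(\<integral>\<^sup>+\<xi>. ennreal (norm (of_real (sqrt (w \<xi>)) * (indicator (cball 0 R) \<xi> *\<^sub>R h \<xi>))) \<partial>lborel)
     \<le> (\<integral>\<^sup>+\<xi>. ennreal (w \<xi>) * indicator (cball 0 R) \<xi> + ennreal ((cmod (h \<xi>))\<^sup>2) \<partial>lborel)"
    by (intro nn_integral_mono)
  also have "\<dots> = (\<integral>\<^sup>+\<xi>. ennreal (w \<xi>) * indicator (cball 0 R) \<xi> \<partial>lborel) + energy h"
    by (simp add: nn_integral_add energy_def)
  also have "\<dots> < \<infinity>"
    using h weight_locally_finite[of R] by (simp add: L2_iff_energy)
  finally show "(\<integral>\<^sup>+\<xi>. ennreal (norm (of_real (sqrt (w \<xi>)) * (indicator (cball 0 R) \<xi> *\<^sub>R h \<xi>))) \<partial>lborel) < \<infinity>" .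
qed

lemma osc_diff:
  assumes "integrable lborel f" "integrable lborel g"
  shows "osc f \<tau> - osc g \<tau> = osc (\<lambda>\<xi>. f \<xi> - g \<xi>) \<tau>"
  unfolding osc_def
  by (subst Bochner_Integration.integral_diff[symmetric])
     (auto intro!: integrable_osc_kernel assms simp: right_diff_distrib)

text \<open>The cutoff is on the frequency side \<open>\<xi>\<close>, not on the image \<open>\<Phi> \<xi>\<close>, to agree with
  \<^const>\<open>multiplier_trunc\<close> and with the truncations in \<^const>\<open>fourier_L2\<close>.\<close>
definition osc_trunc :: "('a \<Rightarrow> complex) \<Rightarrow> real \<Rightarrow> 'b \<Rightarrow> complex" where
  "osc_trunc h R = osc (\<lambda>\<xi>. of_real (sqrt (w \<xi>)) * (indicator (cball 0 R) \<xi> *\<^sub>R h \<xi>))"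

lemma osc_trunc_energy_le:
  assumes h: "h \<in> L2"
  shows "energy (osc_trunc h R) \<le> ennreal (B * (2 * pi) ^ DIM('b)) * energy h"
proof -
  have [measurable]: "h \<in> borel_measurable borel" using h L2_measurable by auto
  have "energy (osc_trunc h R) \<le> ennreal (B * (2 * pi) ^ DIM('b)) * energy (\<lambda>\<xi>. indicator (cball 0 R) \<xi> *\<^sub>R h \<xi>)"
    unfolding osc_trunc_def by (intro osc_energy_le integrable_truncated h) measurable
  also have "\<dots> \<le> ennreal (B * (2 * pi) ^ DIM('b)) * energy h"
    by (intro mult_left_mono energy_mono) (auto simp: indicator_def)
  finally show ?thesis .
qed

text \<open>By linearity and the energy bound, the transforms form a Cauchy family because the truncations
  of \<open>h\<close> do.\<close>
lemma osc_trunc_converges: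
  assumes h: "h \<in> L2"
  shows "\<exists>u. osc_trunc h has_L2_limit u"
proof (rule L2_complete)
  have [measurable]: "h \<in> borel_measurable borel" using h L2_measurable by auto
  have hfin: "energy h < \<infinity>" using h by (simp add: L2_iff_energy)
  show "osc_trunc h R \<in> L2" for R
    unfolding L2_iff_energy
  proof
    show "osc_trunc h R \<in> borel_measurable borel" unfolding osc_trunc_def by measurable
    show "energy (osc_trunc h R) < \<infinity>"
      using osc_trunc_energy_le[OF h, of R] hfin
      by (auto intro: le_less_trans simp: ennreal_mult_less_top)
  qed
  define K where "K = B * (2 * pi) ^ DIM('b)"
  have K: "0 \<le> K" using B_nonneg by (simp add: K_def)
  define hR where "hR R \<xi> = indicator (cball 0 R) \<xi> *\<^sub>R h \<xi>" for R \<xi>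
  have [measurable]: "hR R \<in> borel_measurable borel" for R unfolding hR_def[abs_def] by measurable
  have diff: "energy (\<lambda>x. osc_trunc h R x - osc_trunc h S x)
       \<le> ennreal K * (2 * energy (\<lambda>\<xi>. hR R \<xi> - h \<xi>) + 2 * energy (\<lambda>\<xi>. hR S \<xi> - h \<xi>))" for R S
  proof -
    have int: "integrable lborel (\<lambda>\<xi>. of_real (sqrt (w \<xi>)) * hR R \<xi>)" for R
      using integrable_truncated[OF h] by (simp add: hR_def)
    have "energy (\<lambda>x. osc_trunc h R x - osc_trunc h S x) = energy (osc (\<lambda>\<xi>. of_real (sqrt (w \<xi>)) * (hR R \<xi> - hR S \<xi>)))"
      using int by (simp add: osc_trunc_def hR_def[symmetric] osc_diff right_diff_distrib)
    also have "\<dots> \<le> ennreal K * energy (\<lambda>\<xi>. hR R \<xi> - hR S \<xi>)"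
      unfolding K_def using Bochner_Integration.integrable_diff[OF int int]
      by (intro osc_energy_le) (auto simp: right_diff_distrib)
    also have "\<dots> \<le> ennreal K * (2 * energy (\<lambda>\<xi>. hR R \<xi> - h \<xi>) + 2 * energy (\<lambda>\<xi>. h \<xi> - hR S \<xi>))"
      using energy_add_le[of "\<lambda>\<xi>. hR R \<xi> - h \<xi>" "\<lambda>\<xi>. h \<xi> - hR S \<xi>"] by (intro mult_left_mono) simp_all
    finally show ?thesis
      by (simp only: energy_minus_commute[of h])
  qed
  fix e :: real assume "e > 0"
  define d where "d = e / (4 * K + 1)"
  have d: "0 < d" "(4 * K + 1) * d = e" using K \<open>e > 0\<close> by (simp_all add: d_def)
  have "((\<lambda>R. energy (\<lambda>\<xi>. hR R \<xi> - h \<xi>)) \<longlongrightarrow> 0) at_top"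
    using truncation_has_L2_limit[OF h] by (simp add: has_L2_limit_iff_energy hR_def)
  moreover have "0 < ennreal d" using d by simp
  ultimately obtain R0 where R0: "\<And>R. R \<ge> R0 \<Longrightarrow> energy (\<lambda>\<xi>. hR R \<xi> - h \<xi>) < ennreal d"
    using order_tendstoD(2) by (fastforce simp: eventually_at_top_linorder)
  show "\<exists>R0. \<forall>R\<ge>R0. \<forall>S\<ge>R0. energy (\<lambda>x. osc_trunc h R x - osc_trunc h S x) \<le> ennreal e"
  proof (intro exI allI impI)
    fix R S assume "R0 \<le> R" "R0 \<le> S"
    have "ennreal K * (2 * energy (\<lambda>\<xi>. hR R \<xi> - h \<xi>) + 2 * energy (\<lambda>\<xi>. hR S \<xi> - h \<xi>))
       \<le> ennreal K * (2 * ennreal d + 2 * ennreal d)"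
      by (intro mult_left_mono add_mono less_imp_le[OF R0]) (auto simp: \<open>R0 \<le> R\<close> \<open>R0 \<le> S\<close>)
    also have "\<dots> = ennreal (K * (2 * d + 2 * d))"
      using K d by (simp add: ennreal_mult[symmetric] ennreal_numeral[symmetric] ennreal_plus[symmetric]
          del: ennreal_plus ennreal_numeral)
    also have "\<dots> \<le> ennreal ((4 * K + 1) * d)"
      using d by (intro ennreal_leI) (simp add: algebra_simps)
    finally show "energy (\<lambda>x. osc_trunc h R x - osc_trunc h S x) \<le> ennreal e"
      using diff order_trans unfolding d(2) by blast
  qed
qed

lemma osc_trunc_limit_le:
  assumes h: "h \<in> L2" and u: "osc_trunc h has_L2_limit u"
  shows "L2norm u \<le> sqrt (2 * B * (2 * pi) ^ DIM('b)) * L2norm h"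
proof -
  have "u \<in> L2" using u by (simp add: has_L2_limit_def)
  have "energy u \<le> 2 * (ennreal (B * (2 * pi) ^ DIM('b)) * energy h)"
    using u osc_trunc_energy_le[OF h] by (rule L2_limit_energy_le)
  also have "\<dots> = ennreal (2 * B * (2 * pi) ^ DIM('b) * (L2norm h)\<^sup>2)"
    using B_nonneg by (simp add: energy_eq_L2norm[OF h] ennreal_mult ennreal_numeral[symmetric] mult.assoc del: ennreal_numeral)
  finally have "(L2norm u)\<^sup>2 \<le> 2 * B * (2 * pi) ^ DIM('b) * (L2norm h)\<^sup>2"
    using B_nonneg by (simp add: energy_eq_L2norm[OF \<open>u \<in> L2\<close>])
  then have "sqrt ((L2norm u)\<^sup>2) \<le> sqrt (2 * B * (2 * pi) ^ DIM('b) * (L2norm h)\<^sup>2)"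
    by (rule real_sqrt_le_mono)
  then show ?thesis by (simp add: real_sqrt_mult)
qed

end

lemma nn_integral_uminus:
  fixes F :: "'a::euclidean_space \<Rightarrow> ennreal"
  assumes [measurable]: "F \<in> borel_measurable borel"
  shows "(\<integral>\<^sup>+x. F (- x) \<partial>lborel) = (\<integral>\<^sup>+x. F x \<partial>lborel)"
proof -
  have "(\<integral>\<^sup>+x. F x \<partial>lborel) = (\<integral>\<^sup>+x. F (0 + (-1) *\<^sub>R x) \<partial>lborel)"
    by (subst lborel_affine[of "-1" "0::'a"]) (simp_all add: nn_integral_density nn_integral_distr)
  then show ?thesis by simp
qed

section \<open>The Fourier transform and the reduction of multiplier estimates\<close>

text \<open>The kernel of the Fourier transform is $e^{-i x \cdot \xi}$, whence the sign of the phase.\<close>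
interpretation fourier: weighted_phase "\<lambda>x::'a::euclidean_space. - x" "\<lambda>_. 1" 1
proof
  show "(\<integral>\<^sup>+\<xi>. ennreal 1 * indicator (cball 0 R) (\<xi>::'a) \<partial>lborel) < \<infinity>" for R
    using emeasure_lborel_cball_finite[of "0::'a" R] by simp
  show "(\<integral>\<^sup>+\<xi>. F (- \<xi>) * ennreal 1 \<partial>lborel) \<le> ennreal 1 * (\<integral>\<^sup>+s. F s \<partial>lborel)"
    if "F \<in> borel_measurable borel" for F :: "'a \<Rightarrow> ennreal"
    using nn_integral_uminus[OF that] by simp
qed auto

lemma fourier_osc_trunc:
  "fourier.osc_trunc \<phi> R \<xi> = (LINT x:cball 0 R|lborel. exp (- \<i> * of_real (x \<bullet> \<xi>)) * \<phi> x)"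
  unfolding fourier.osc_trunc_def fourier.osc_def set_lebesgue_integral_def
  by (intro Bochner_Integration.integral_cong) (auto simp: inner_commute scaleR_conv_of_real)

text \<open>The transforms of the truncations converge, so the choice in the definition of
  \<^const>\<open>fourier_L2\<close> is made from a nonempty set.\<close>
lemma fourier_L2_limit:
  assumes "\<phi> \<in> L2"
  shows "fourier.osc_trunc \<phi> has_L2_limit fourier_L2 \<phi>"
  using someI_ex[OF fourier.osc_trunc_converges[OF assms]]
  by (simp add: fourier_L2_def fourier_osc_trunc[abs_def])

lemma fourier_L2_in_L2: "\<phi> \<in> L2 \<Longrightarrow> fourier_L2 \<phi> \<in> L2"
  using fourier_L2_limit by (auto simp: has_L2_limit_def)

lemma L2norm_fourier_L2_le:
  fixes \<phi> :: "'a::euclidean_space \<Rightarrow> complex"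
  shows "\<phi> \<in> L2 \<Longrightarrow> L2norm (fourier_L2 \<phi>) \<le> sqrt (2 * (2 * pi) ^ DIM('a)) * L2norm \<phi>"
  using fourier.osc_trunc_limit_le[OF _ fourier_L2_limit] by simp

lemma L2norm_mult_bounded:
  assumes c: "c \<in> borel_measurable borel" "\<And>x. cmod (c x) = K" and f: "f \<in> L2"
  shows "(\<lambda>x. c x * f x) \<in> L2" "L2norm (\<lambda>x. c x * f x) = K * L2norm f"
proof -
  have [measurable]: "f \<in> borel_measurable borel" "c \<in> borel_measurable borel" using f c L2_measurable by auto
  have "0 \<le> K" using c(2)[of undefined] norm_ge_zero[of "c undefined"] by simp
  have "(\<lambda>x. c x * f x) \<in> borel_measurable borel" by measurable
  then show "(\<lambda>x. c x * f x) \<in> L2" using f by (simp add: L2_def norm_mult c power_mult_distrib)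
  show "L2norm (\<lambda>x. c x * f x) = K * L2norm f"
    using \<open>0 \<le> K\<close> by (simp add: L2norm_def norm_mult c power_mult_distrib real_sqrt_mult)
qed

text \<open>Evaluating $a_\tau(D)\varphi$ at the point \<open>p \<tau>\<close> gives an oscillatory transform of $\hat\varphi$ as soon as
  its kernel is $\sqrt w\, e^{i \tau \cdot \Phi}$ up to a constant and a factor \<open>\<theta>\<close> of modulus one that does not
  depend on \<open>\<tau>\<close>. In both estimates \<open>\<theta>\<close> is $e^{i x \xi}$ with \<open>x\<close> the fixed spatial variable; since
  only its modulus enters the bound, the constant is uniform in \<open>x\<close>.\<close>
lemma (in weighted_phase) multiplier_estimate:
  fixes a :: "'b \<Rightarrow> 'a \<Rightarrow> complex" and p :: "'b \<Rightarrow> 'a" and \<theta> :: "'a \<Rightarrow> complex" and c :: real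
  assumes \<phi>: "\<phi> \<in> L2" and c: "0 \<le> c"
    and [measurable]: "\<And>\<tau>. a \<tau> \<in> borel_measurable borel"
    and \<theta>: "\<theta> \<in> borel_measurable borel" "\<And>\<xi>. cmod (\<theta> \<xi>) = 1"
    and factor: "\<And>\<tau>. AE \<xi> in lborel. exp (\<i> * of_real (p \<tau> \<bullet> \<xi>)) * a \<tau> \<xi>
        = of_real c * \<theta> \<xi> * of_real (sqrt (w \<xi>)) * exp (\<i> * of_real (\<tau> \<bullet> \<Phi> \<xi>))"
  shows "\<exists>u. (\<lambda>R \<tau>. multiplier_trunc (a \<tau>) \<phi> R (p \<tau>)) has_L2_limit u \<and>
    L2norm u \<le> sqrt (2 * B * (2 * pi) ^ DIM('b)) * (c / (2 * pi) ^ DIM('a)) * sqrt (2 * (2 * pi) ^ DIM('a)) * L2norm \<phi>"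
proof -
  have [measurable]: "\<theta> \<in> borel_measurable borel" by fact
  have [measurable]: "fourier_L2 \<phi> \<in> borel_measurable borel"
    using fourier_L2_in_L2[OF \<phi>] L2_measurable by auto
  define k where "k = c / (2 * pi) ^ DIM('a)"
  have k: "0 \<le> k" using c by (simp add: k_def)
  define h where "h \<xi> = (of_real k * \<theta> \<xi>) * fourier_L2 \<phi> \<xi>" for \<xi>
  have h: "h \<in> L2" "L2norm h = k * L2norm (fourier_L2 \<phi>)"
    using L2norm_mult_bounded[of "\<lambda>\<xi>. of_real k * \<theta> \<xi>" k, OF _ _ fourier_L2_in_L2[OF \<phi>]] k
    by (auto simp: h_def[abs_def] norm_mult \<theta>)
  have [measurable]: "h \<in> borel_measurable borel" using h L2_measurable by auto
  have eq: "multiplier_trunc (a \<tau>) \<phi> R (p \<tau>) = osc_trunc h R \<tau>" for R \<tau>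
  proof -
    have "(LINT \<xi>|lborel. (indicator (cball 0 R) \<xi> *\<^sub>R (exp (\<i> * of_real (p \<tau> \<bullet> \<xi>)) * a \<tau> \<xi> * fourier_L2 \<phi> \<xi>)) / of_real ((2 * pi) ^ DIM('a)))
       = (LINT \<xi>|lborel. exp (\<i> * of_real (\<tau> \<bullet> \<Phi> \<xi>)) * (of_real (sqrt (w \<xi>)) * (indicator (cball 0 R) \<xi> *\<^sub>R h \<xi>)))"
    proof (rule integral_cong_AE)
      show "AE \<xi> in lborel. (indicator (cball 0 R) \<xi> *\<^sub>R (exp (\<i> * of_real (p \<tau> \<bullet> \<xi>)) * a \<tau> \<xi> * fourier_L2 \<phi> \<xi>)) / of_real ((2 * pi) ^ DIM('a))
         = exp (\<i> * of_real (\<tau> \<bullet> \<Phi> \<xi>)) * (of_real (sqrt (w \<xi>)) * (indicator (cball 0 R) \<xi> *\<^sub>R h \<xi>))"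
        using factor[of \<tau>] by eventually_elim (simp add: h_def k_def scaleR_conv_of_real)
    qed measurable
    then show ?thesis
      by (simp add: multiplier_trunc_def osc_trunc_def osc_def set_lebesgue_integral_def)
  qed
  obtain u where u: "osc_trunc h has_L2_limit u"
    using osc_trunc_converges[OF h(1)] by blast
  have "L2norm u \<le> sqrt (2 * B * (2 * pi) ^ DIM('b)) * (k * L2norm (fourier_L2 \<phi>))"
    using osc_trunc_limit_le[OF h(1) u] by (simp only: h(2))
  also have "\<dots> \<le> sqrt (2 * B * (2 * pi) ^ DIM('b)) * (k * (sqrt (2 * (2 * pi) ^ DIM('a)) * L2norm \<phi>))"
    using k B_nonneg by (intro mult_left_mono L2norm_fourier_L2_le \<phi>) auto
  finally show ?thesis
    using u by (intro exI[of _ u]) (simp add: eq k_def mult.assoc)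
qed

section \<open>The phases of the four estimates\<close>

text \<open>Substituting $s = \xi^m$ on the intervals $[1/n, n]$, which avoid the singularity of the Jacobian
  at 0 when $m < 1$, and letting $n \to \infty$.\<close>
lemma nn_integral_powr_half_line_le:
  fixes F :: "real \<Rightarrow> ennreal" and m :: real
  assumes m: "m > 0" and [measurable]: "F \<in> borel_measurable borel"
  shows "(\<integral>\<^sup>+\<xi>. F (\<xi> powr m) * ennreal (m * \<xi> powr (m - 1)) * indicator {0<..} \<xi> \<partial>lborel) \<le> (\<integral>\<^sup>+s. F s \<partial>lborel)"
proof -
  define I where "I n = {1 / real (Suc n) .. real (Suc n)}" for n
  have [measurable]: "I n \<in> sets borel" for n by (simp add: I_def)
  let ?G = "\<lambda>\<xi>. F (\<xi> powr m) * ennreal (m * \<xi> powr (m - 1))"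
  have piece: "(\<integral>\<^sup>+\<xi>. ?G \<xi> * indicator (I n) \<xi> \<partial>lborel) \<le> (\<integral>\<^sup>+s. F s \<partial>lborel)" for n
  proof -
    have "(\<integral>\<^sup>+s. F s * indicator {(1 / real (Suc (Suc n))) powr m .. real (Suc (Suc n)) powr m} s \<partial>lborel)
       = (\<integral>\<^sup>+\<xi>. ?G \<xi> * indicator (I (Suc n)) \<xi> \<partial>lborel)"
      unfolding I_def
    proof (rule nn_integral_substitution_aux)
      fix \<xi> :: real assume "\<xi> \<in> {1 / real (Suc (Suc n)) .. real (Suc (Suc n))}"
      moreover have "0 < 1 / real (Suc (Suc n))" by simp
      ultimately have "0 < \<xi>" by (simp only: atLeastAtMost_iff) linarith
      then show "((\<lambda>\<xi>. \<xi> powr m) has_real_derivative m * \<xi> powr (m - 1)) (at \<xi>)"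
        by (rule has_real_derivative_powr)
      show "0 \<le> m * \<xi> powr (m - 1)" using m by simp
    next
      show "continuous_on {1 / real (Suc (Suc n)) .. real (Suc (Suc n))} (\<lambda>\<xi>. m * \<xi> powr (m - 1))"
      proof (intro continuous_intros ballI)
        fix \<xi> :: real assume "\<xi> \<in> {1 / real (Suc (Suc n)) .. real (Suc (Suc n))}"
        moreover have "0 < 1 / real (Suc (Suc n))" by simp
        ultimately show "\<xi> \<noteq> 0" by auto
      qed
      have "1 / real (Suc (Suc n)) < 1" by simp
      also have "1 < real (Suc (Suc n))" by simp
      finally show "1 / real (Suc (Suc n)) < real (Suc (Suc n))" .
    qed auto
    moreover have "(\<integral>\<^sup>+\<xi>. ?G \<xi> * indicator (I n) \<xi> \<partial>lborel) \<le> (\<integral>\<^sup>+\<xi>. ?G \<xi> * indicator (I (Suc n)) \<xi> \<partial>lborel)"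
    proof (intro nn_integral_mono mult_left_mono)
      have "I n \<subseteq> I (Suc n)" unfolding I_def by (auto intro: order_trans[rotated] simp: frac_le)
      then show "(indicator (I n) \<xi> :: ennreal) \<le> indicator (I (Suc n)) \<xi>" for \<xi>
        by (auto simp: indicator_def)
    qed simp
    moreover have "(\<integral>\<^sup>+s. F s * indicator {(1 / real (Suc (Suc n))) powr m .. real (Suc (Suc n)) powr m} s \<partial>lborel)
       \<le> (\<integral>\<^sup>+s. F s \<partial>lborel)"
      by (intro nn_integral_mono) (auto simp: indicator_def)
    ultimately show ?thesis by simp
  qed
  have lim: "(\<lambda>n. ?G \<xi> * indicator (I n) \<xi>) \<longlonglongrightarrow> ?G \<xi> * indicator {0<..} \<xi>" for \<xi>
  proof (intro tendsto_eventually)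
    show "\<forall>\<^sub>F n in sequentially. ?G \<xi> * indicator (I n) \<xi> = ?G \<xi> * indicator {0<..} \<xi>"
    proof (cases "\<xi> > 0")
      case True
      obtain N where N: "max \<xi> (1 / \<xi>) < real N" using reals_Archimedean2 by blast
      show ?thesis
        using eventually_ge_at_top[of N]
      proof eventually_elim
        case (elim n)
        then have "max \<xi> (1 / \<xi>) \<le> real (Suc n)" using N by linarith
        then have "\<xi> \<in> I n" using True by (auto simp: I_def field_simps)
        then show ?case using True by simp
      qed
    next
      case False
      then have "\<xi> \<notin> I n" for n
      proof -
        have "0 < 1 / real (Suc n)" by simp
        then show ?thesis using False by (simp only: I_def atLeastAtMost_iff) linarith
      qed
      then show ?thesis using False by simp
    qed
  qed
  have "(\<integral>\<^sup>+\<xi>. ?G \<xi> * indicator {0<..} \<xi> \<partial>lborel) = (\<integral>\<^sup>+\<xi>. liminf (\<lambda>n. ?G \<xi> * indicator (I n) \<xi>) \<partial>lborel)"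
    by (intro nn_integral_cong lim_imp_Liminf[symmetric] lim) simp
  also have "\<dots> \<le> liminf (\<lambda>n. \<integral>\<^sup>+\<xi>. ?G \<xi> * indicator (I n) \<xi> \<partial>lborel)"
    by (intro nn_integral_liminf) measurable
  also have "\<dots> \<le> (\<integral>\<^sup>+s. F s \<partial>lborel)"
    by (intro Liminf_le always_eventually allI piece) simp
  finally show ?thesis .
qed

text \<open>The factor 2 arises because $\xi \mapsto |\xi|^m$ is two-to-one.\<close>
lemma nn_integral_abs_powr_le:
  fixes F :: "real \<Rightarrow> ennreal" and m :: real
  assumes m: "m > 0" and [measurable]: "F \<in> borel_measurable borel"
  shows "(\<integral>\<^sup>+\<xi>. F (\<bar>\<xi>\<bar> powr m) * ennreal (m * \<bar>\<xi>\<bar> powr (m - 1)) \<partial>lborel) \<le> ennreal 2 * (\<integral>\<^sup>+s. F s \<partial>lborel)"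
proof -
  define G where "G \<xi> = F (\<xi> powr m) * ennreal (m * \<xi> powr (m - 1)) * indicator {0<..} \<xi>" for \<xi>
  have [measurable]: "G \<in> borel_measurable borel" unfolding G_def[abs_def] by measurable
  \<comment> \<open>At \<open>\<xi> = 0\<close> the left-hand integrand vanishes because \<open>0 powr (m - 1) = 0\<close>, also for \<open>m = 1\<close>.\<close>
  have "(\<integral>\<^sup>+\<xi>. F (\<bar>\<xi>\<bar> powr m) * ennreal (m * \<bar>\<xi>\<bar> powr (m - 1)) \<partial>lborel) = (\<integral>\<^sup>+\<xi>. G \<xi> + G (- \<xi>) \<partial>lborel)"
    by (intro nn_integral_cong) (auto simp: G_def indicator_def not_less)
  also have "\<dots> = (\<integral>\<^sup>+\<xi>. G \<xi> \<partial>lborel) + (\<integral>\<^sup>+\<xi>. G \<xi> \<partial>lborel)"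
    by (simp add: nn_integral_add nn_integral_uminus)
  also have "\<dots> \<le> (\<integral>\<^sup>+s. F s \<partial>lborel) + (\<integral>\<^sup>+s. F s \<partial>lborel)"
    unfolding G_def by (intro add_mono nn_integral_powr_half_line_le assms)
  finally show ?thesis by (simp add: mult_2)
qed

text \<open>The pushforward bound applied to the image of the ball, the interval $[0, R^m]$. This is where
  $m > 0$ is indispensable: $|\xi|^{m-1}$ is not integrable at 0 otherwise.\<close>
lemma nn_integral_abs_powr_cball_finite:
  assumes m: "m > 0"
  shows "(\<integral>\<^sup>+\<xi>. ennreal (m * \<bar>\<xi>\<bar> powr (m - 1)) * indicator (cball 0 R) \<xi> \<partial>lborel) < \<infinity>"
proof -
  have "(\<integral>\<^sup>+\<xi>. ennreal (m * \<bar>\<xi>\<bar> powr (m - 1)) * indicator (cball 0 R) \<xi> \<partial>lborel)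
     \<le> (\<integral>\<^sup>+\<xi>. indicator {0..R powr m} (\<bar>\<xi>\<bar> powr m) * ennreal (m * \<bar>\<xi>\<bar> powr (m - 1)) \<partial>lborel)"
    using m by (intro nn_integral_mono) (auto simp: indicator_def intro: powr_mono2)
  also have "\<dots> \<le> ennreal 2 * (\<integral>\<^sup>+s. indicator {0..R powr m} s \<partial>lborel)"
    by (rule nn_integral_abs_powr_le[OF m]) simp
  also have "\<dots> < \<infinity>" by (simp add: ennreal_mult_less_top)
  finally show ?thesis .
qed

lemma weighted_phase_1d:
  assumes m: "m > 0"
  shows "weighted_phase (\<lambda>\<xi>::real. \<bar>\<xi>\<bar> powr m) (\<lambda>\<xi>. m * \<bar>\<xi>\<bar> powr (m - 1)) 2"
  by standard (use m nn_integral_abs_powr_le nn_integral_abs_powr_cball_finite in auto)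

text \<open>The case $m = 1$ of the previous lemma up to the null set $\xi = 0$, where \<open>0 powr 0 = 0\<close>.\<close>
lemma weighted_phase_1d_wave: "weighted_phase (\<lambda>\<xi>::real. \<bar>\<xi>\<bar>) (\<lambda>_. 1) 2"
proof
  show "(\<integral>\<^sup>+\<xi>. F \<bar>\<xi>\<bar> * ennreal 1 \<partial>lborel) \<le> ennreal 2 * (\<integral>\<^sup>+s. F s \<partial>lborel)"
    if "F \<in> borel_measurable borel" for F :: "real \<Rightarrow> ennreal"
  proof -
    have "(\<integral>\<^sup>+\<xi>. F \<bar>\<xi>\<bar> * ennreal 1 \<partial>lborel) = (\<integral>\<^sup>+\<xi>. F (\<bar>\<xi>\<bar> powr 1) * ennreal (1 * \<bar>\<xi>\<bar> powr (1 - 1)) \<partial>lborel)"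
      using AE_lborel_singleton[of "0::real"] by (intro nn_integral_cong_AE, eventually_elim) simp
    then show ?thesis using nn_integral_abs_powr_le[OF zero_less_one that] by simp
  qed
  show "(\<integral>\<^sup>+\<xi>. ennreal 1 * indicator (cball 0 R) (\<xi>::real) \<partial>lborel) < \<infinity>" for R
    using emeasure_lborel_cball_finite[of "0::real" R] by simp
qed auto

text \<open>For fixed $\eta \ne 0$ the phase is a linear change of the variable \<open>\<xi>\<close> with factor $|\eta|^{m-1}$, so by
  Tonelli the pushforward of the weight is Lebesgue measure itself.\<close>
lemma weighted_phase_2d:
  assumes m: "m > 0"
  shows "weighted_phase (\<lambda>(\<xi>, \<eta>). (\<xi> * \<bar>\<eta>\<bar> powr (m - 1), \<eta>) :: real \<times> real) (\<lambda>(\<xi>, \<eta>). \<bar>\<eta>\<bar> powr (m - 1)) 1"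
proof
  show "(\<lambda>(\<xi>, \<eta>). (\<xi> * \<bar>\<eta>\<bar> powr (m - 1), \<eta>) :: real \<times> real) \<in> borel_measurable borel"
    "(\<lambda>(\<xi>::real, \<eta>::real). \<bar>\<eta>\<bar> powr (m - 1)) \<in> borel_measurable borel"
    by (simp_all add: borel_prod[symmetric])
next
  fix F :: "real \<times> real \<Rightarrow> ennreal" assume "F \<in> borel_measurable borel"
  then have [measurable]: "F \<in> borel_measurable (borel \<Otimes>\<^sub>M borel)" by (simp add: borel_prod)
  have "(\<integral>\<^sup>+z. F (case z of (\<xi>, \<eta>) \<Rightarrow> (\<xi> * \<bar>\<eta>\<bar> powr (m - 1), \<eta>)) * ennreal (case z of (\<xi>, \<eta>) \<Rightarrow> \<bar>\<eta>\<bar> powr (m - 1)) \<partial>lborel)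
     = (\<integral>\<^sup>+\<eta>. \<integral>\<^sup>+\<xi>. F (\<xi> * \<bar>\<eta>\<bar> powr (m - 1), \<eta>) * ennreal (\<bar>\<eta>\<bar> powr (m - 1)) \<partial>lborel \<partial>lborel)"
    unfolding lborel_prod[symmetric] by (subst lborel_pair.nn_integral_snd[symmetric]) auto
  also have "\<dots> \<le> (\<integral>\<^sup>+\<eta>. \<integral>\<^sup>+s. F (s, \<eta>) \<partial>lborel \<partial>lborel)"
  proof (rule nn_integral_mono)
    fix \<eta> :: real
    show "(\<integral>\<^sup>+\<xi>. F (\<xi> * \<bar>\<eta>\<bar> powr (m - 1), \<eta>) * ennreal (\<bar>\<eta>\<bar> powr (m - 1)) \<partial>lborel) \<le> (\<integral>\<^sup>+s. F (s, \<eta>) \<partial>lborel)"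
    proof (cases "\<eta> = 0")
      case False
      then show ?thesis
        by (subst nn_integral_real_affine[of "\<lambda>s. F (s, \<eta>)" "\<bar>\<eta>\<bar> powr (m - 1)" 0])
           (auto simp: nn_integral_cmult[symmetric] mult_ac)
    qed simp
  qed
  also have "\<dots> = (\<integral>\<^sup>+z. F z \<partial>lborel)"
    unfolding lborel_prod[symmetric] by (subst lborel_pair.nn_integral_snd[symmetric]) auto
  finally show "(\<integral>\<^sup>+z. F (case z of (\<xi>, \<eta>) \<Rightarrow> (\<xi> * \<bar>\<eta>\<bar> powr (m - 1), \<eta>)) * ennreal (case z of (\<xi>, \<eta>) \<Rightarrow> \<bar>\<eta>\<bar> powr (m - 1)) \<partial>lborel)
     \<le> ennreal 1 * (\<integral>\<^sup>+z. F z \<partial>lborel)" by simp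
next
  fix R :: real
  let ?v = "\<lambda>\<eta>::real. ennreal (\<bar>\<eta>\<bar> powr (m - 1)) * indicator (cball 0 R) \<eta>"
  have v: "(\<integral>\<^sup>+\<eta>. ?v \<eta> \<partial>lborel) < \<infinity>"
  proof -
    have "(\<integral>\<^sup>+\<eta>. ?v \<eta> \<partial>lborel) = (\<integral>\<^sup>+\<eta>. ennreal (1 / m) * (ennreal (m * \<bar>\<eta>\<bar> powr (m - 1)) * indicator (cball 0 R) \<eta>) \<partial>lborel)"
      using m by (intro nn_integral_cong) (simp add: ennreal_mult[symmetric] mult.assoc[symmetric])
    also have "\<dots> = ennreal (1 / m) * (\<integral>\<^sup>+\<eta>. ennreal (m * \<bar>\<eta>\<bar> powr (m - 1)) * indicator (cball 0 R) \<eta> \<partial>lborel)"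
      by (intro nn_integral_cmult) measurable
    also have "\<dots> < \<infinity>"
      using nn_integral_abs_powr_cball_finite[OF m, of R] by (simp add: ennreal_mult_less_top)
    finally show ?thesis .
  qed
  have "(\<integral>\<^sup>+z. ennreal (case z of (\<xi>, \<eta>) \<Rightarrow> \<bar>\<eta>\<bar> powr (m - 1)) * indicator (cball 0 R) z \<partial>(lborel :: (real \<times> real) measure))
     \<le> (\<integral>\<^sup>+z. (case z of (\<xi>, \<eta>) \<Rightarrow> indicator (cball 0 R) \<xi> * ?v \<eta>) \<partial>(lborel :: (real \<times> real) measure))"
  proof (intro nn_integral_mono)
    fix z :: "real \<times> real"
    obtain \<xi> \<eta> where z: "z = (\<xi>, \<eta>)" by (cases z)
    have "norm \<xi> \<le> norm z" "norm \<eta> \<le> norm z" unfolding z by (rule norm_fst_le norm_snd_le)+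
    then show "ennreal (case z of (\<xi>, \<eta>) \<Rightarrow> \<bar>\<eta>\<bar> powr (m - 1)) * indicator (cball 0 R) z
       \<le> (case z of (\<xi>, \<eta>) \<Rightarrow> indicator (cball 0 R) \<xi> * ?v \<eta>)"
      by (auto simp: z indicator_def)
  qed
  also have "\<dots> = (\<integral>\<^sup>+(\<xi>::real). \<integral>\<^sup>+\<eta>. indicator (cball 0 R) \<xi> * ?v \<eta> \<partial>lborel \<partial>lborel)"
    unfolding lborel_prod[symmetric] by (subst lborel.nn_integral_fst[symmetric]) auto
  also have "\<dots> = emeasure lborel (cball (0::real) R) * (\<integral>\<^sup>+\<eta>. ?v \<eta> \<partial>lborel)"
    by (simp add: nn_integral_cmult nn_integral_multc)
  also have "\<dots> < \<infinity>"
    using v emeasure_lborel_cball_finite[of "0::real" R] by (simp add: ennreal_mult_less_top)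
  finally show "(\<integral>\<^sup>+z. ennreal (case z of (\<xi>, \<eta>) \<Rightarrow> \<bar>\<eta>\<bar> powr (m - 1)) * indicator (cball 0 R) z \<partial>(lborel :: (real \<times> real) measure)) < \<infinity>" .
qed auto

lemma weighted_phase_id: "weighted_phase (id :: 'a::euclidean_space \<Rightarrow> 'a) (\<lambda>_. 1) 1"
proof
  show "(\<integral>\<^sup>+\<xi>. ennreal 1 * indicator (cball 0 R) (\<xi>::'a) \<partial>lborel) < \<infinity>" for R
    using emeasure_lborel_cball_finite[of "0::'a" R] by simp
qed auto

lemma time_estimate_1d_if_phase:
  fixes a :: "real \<Rightarrow> real \<Rightarrow> complex" and c :: real
  assumes phase: "weighted_phase \<Phi> w B" and c: "0 \<le> c"
    and a: "\<And>t. a t \<in> borel_measurable borel"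
    and factor: "\<And>t \<xi>. a t \<xi> = of_real (c * sqrt (w \<xi>)) * exp (\<i> * of_real (t * \<Phi> \<xi>))"
  shows "time_estimate_1d a"
proof -
  interpret weighted_phase \<Phi> w B by (rule phase)
  have "\<exists>u. (\<lambda>R t. multiplier_trunc (a t) \<phi> R x) has_L2_limit u \<and>
      L2norm u \<le> sqrt (2 * B * (2 * pi) ^ DIM(real)) * (c / (2 * pi) ^ DIM(real)) * sqrt (2 * (2 * pi) ^ DIM(real)) * L2norm \<phi>"
    if "\<phi> \<in> L2" for x and \<phi> :: "real \<Rightarrow> complex"
    by (rule multiplier_estimate[where \<theta>="\<lambda>\<xi>. exp (\<i> * of_real (x * \<xi>))"])
       (use that c a in \<open>auto simp: factor\<close>)
  then show ?thesis unfolding time_estimate_1d_def by blast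
qed

text \<open>In two dimensions \<open>y\<close> is among the variables of the norm, so \<open>\<tau>\<close> is \<open>(t, y)\<close> and the frequency \<open>\<eta>\<close>
  dual to \<open>y\<close> is the second component of the phase.\<close>
lemma time_estimate_2d_if_phase:
  fixes a :: "real \<Rightarrow> real \<times> real \<Rightarrow> complex" and \<psi> :: "real \<times> real \<Rightarrow> real"
  assumes phase: "weighted_phase (\<lambda>(\<xi>, \<eta>). (\<psi> (\<xi>, \<eta>), \<eta>)) w B"
    and a: "\<And>t. a t \<in> borel_measurable borel"
    and factor: "\<And>t \<xi> \<eta>. a t (\<xi>, \<eta>) = of_real (sqrt (w (\<xi>, \<eta>))) * exp (\<i> * of_real (t * \<psi> (\<xi>, \<eta>)))"
  shows "time_estimate_2d a"
proof -
  interpret weighted_phase "\<lambda>(\<xi>, \<eta>). (\<psi> (\<xi>, \<eta>), \<eta>)" w B by (rule phase)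
  have "\<exists>u. (\<lambda>R \<tau>. multiplier_trunc (a (fst \<tau>)) \<phi> R (x, snd \<tau>)) has_L2_limit u \<and>
      L2norm u \<le> sqrt (2 * B * (2 * pi) ^ DIM(real \<times> real)) * (1 / (2 * pi) ^ DIM(real \<times> real))
         * sqrt (2 * (2 * pi) ^ DIM(real \<times> real)) * L2norm \<phi>"
    if "\<phi> \<in> L2" for x and \<phi> :: "real \<times> real \<Rightarrow> complex"
  proof (rule multiplier_estimate[where \<theta>="\<lambda>\<xi>. exp (\<i> * of_real (x * fst \<xi>))"])
    show "AE \<xi> in lborel. exp (\<i> * of_real ((x, snd \<tau>) \<bullet> \<xi>)) * a (fst \<tau>) \<xi>
        = of_real 1 * exp (\<i> * of_real (x * fst \<xi>)) * of_real (sqrt (w \<xi>)) *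
          exp (\<i> * of_real (\<tau> \<bullet> (case \<xi> of (\<xi>, \<eta>) \<Rightarrow> (\<psi> (\<xi>, \<eta>), \<eta>))))" for \<tau>
      by (intro AE_I2) (cases \<tau>, auto simp: factor exp_add distrib_left split: prod.split)
  qed (use that a in \<open>auto simp: borel_prod[symmetric]\<close>)
  then show ?thesis unfolding time_estimate_2d_def case_prod_unfold by blast
qed

theorem theorem3p1:
  fixes m :: real
  assumes "m > 0"
  shows "time_estimate_1d (symbol_1d m) \<and>
         time_estimate_2d (symbol_2d m) \<and>
         (time_estimate_1d (symbol_1d m) \<longleftrightarrow>
          time_estimate_1d (\<lambda>t \<xi>. exp (\<i> * of_real (t * \<bar>\<xi>\<bar>)))) \<and>
         (time_estimate_2d (symbol_2d m) \<longleftrightarrow>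
          time_estimate_2d (\<lambda>t (\<xi>, \<eta>). exp (\<i> * of_real (t * \<xi>))))"
proof -
  have half: "sqrt (r powr (m - 1)) = r powr ((m - 1) / 2)" for r :: real
    by (simp add: powr_half_sqrt[symmetric] powr_powr)
  have "time_estimate_1d (symbol_1d m)"
    by (rule time_estimate_1d_if_phase[OF weighted_phase_1d[OF assms], where c="1 / sqrt m"])
       (use assms in \<open>auto simp: symbol_1d_def[abs_def] real_sqrt_mult half\<close>)
  moreover have "time_estimate_1d (\<lambda>t \<xi>. exp (\<i> * of_real (t * \<bar>\<xi>\<bar>)))"
    by (rule time_estimate_1d_if_phase[OF weighted_phase_1d_wave, where c=1]) auto
  moreover have "time_estimate_2d (symbol_2d m)"
  proof (rule time_estimate_2d_if_phase[where \<psi>="\<lambda>(\<xi>, \<eta>). \<xi> * \<bar>\<eta>\<bar> powr (m - 1)"])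
    show "weighted_phase (\<lambda>(\<xi>, \<eta>). ((case (\<xi>, \<eta>) of (\<xi>, \<eta>) \<Rightarrow> \<xi> * \<bar>\<eta>\<bar> powr (m - 1)), \<eta>)) (\<lambda>(\<xi>, \<eta>). \<bar>\<eta>\<bar> powr (m - 1)) 1"
      using weighted_phase_2d[OF assms] by simp
  qed (auto simp: symbol_2d_def half mult.assoc borel_prod[symmetric])
  moreover have "time_estimate_2d (\<lambda>t (\<xi>, \<eta>). exp (\<i> * of_real (t * \<xi>)))"
    by (rule time_estimate_2d_if_phase[where \<psi>=fst and w="\<lambda>_. 1" and B=1])
       (use weighted_phase_id in \<open>auto simp: borel_prod[symmetric]\<close>)
  ultimately show ?thesis by blast
qed

end
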